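(* For any seminormed ring $R$, the topological space $\mathrm{Spec}_{\mathrm{Top}}(R)$ (the topological spectrum of $R$) is quasi-compact and sober. If $R$ is a Noetherian Banach algebra over some nonarchimedean field, then every (proper) radical ideal of $R$ is spectrally reduced, and thus $\mathrm{Spec}_{\mathrm{Top}}(R)$ coincides with $\mathrm{Spec}(R)$.
   Context: All rings are commutative with $1$. A seminorm on a ring $A$ is a function $\lVert\cdot\rVert: A\to\mathbb{R}_{\geq 0}$ with $\lVert 0\rVert=0$, $\lVert 1\rVert=1$, $\lVert -f\rVert=\lVert f\rVert$, $\lVert f+g\rVert\leq\max(\lVert f\rVert,\lVert g\rVert)$ and (submultiplicativity) $\lVert fg\rVert\leq\lVert f\rVert\lVert g\rVert$; it is a norm if $\lVert f\rVert=0$ only for $f=0$. A seminormed ring is a ring equipped with a seminorm; only nontrivially normed rings are considered (the trivial norm, with $\lVert f\rVert=1$ for all $f\neq 0$, is excluded). A seminorm is power-multiplicative if $\lVert f^n\rVert=\lVert f\rVert^n$ for all $f$ and all $n\ge 0$. A seminorm $\phi$ on a seminormed ring $(A,\lVert\cdot\rVert)$ is bounded if there is $C>0$ with $\phi(f)\leq C\lVert f\rVert$ for all $f\in A$. A nonarchimedean field is a field complete with respect to a nontrivial nonarchimedean absolute value. A Banach algebra over a nonarchimedean field $K$ is a $K$-algebra that is complete for a submultiplicative norm with $\lVert\lambda f\rVert=|\lambda|\lVert f\rVert$ for $\lambda\in K$; it is Noetherian if its underlying ring is. An ideal $J\subsetneq A$ of a seminormed ring $A$ is spectrally reduced if $J=\ker(\phi)=\{f:\phi(f)=0\}$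 for some bounded power-multiplicative seminorm $\phi$ on $A$. The topological spectrum $\mathrm{Spec}_{\mathrm{Top}}(A)$ is the set of spectrally reduced prime ideals of $A$ with the subspace topology induced from the Zariski topology on $\mathrm{Spec}(A)$. A topological space is sober if every irreducible closed subset has a unique generic point. *)

theory Defs
  imports
    "HOL-Algebra.Module"
    "HOL-Algebra.Ring_Divisibility"
    "HOL-Analysis.Abstract_Metric_Spaces"
begin

text \<open>Seminorms are total functions of type \<^typ>\<open>'a \<Rightarrow> real\<close>; only their values on the carrier matter.\<close>

locale ring_seminorm = cring R for R :: "('a, 'm) ring_scheme" (structure) and nrm :: "'a \<Rightarrow> real" +
  assumes nrm_nonneg: "f \<in> carrier R \<Longrightarrow> 0 \<le> nrm f"
    and nrm_zero: "nrm \<zero> = 0"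
    and nrm_one: "nrm \<one> = 1"
    and nrm_minus: "f \<in> carrier R \<Longrightarrow> nrm (\<ominus> f) = nrm f"
    and nrm_add: "\<lbrakk>f \<in> carrier R; g \<in> carrier R\<rbrakk> \<Longrightarrow> nrm (f \<oplus> g) \<le> max (nrm f) (nrm g)"
    and nrm_mult: "\<lbrakk>f \<in> carrier R; g \<in> carrier R\<rbrakk> \<Longrightarrow> nrm (f \<otimes> g) \<le> nrm f * nrm g"

locale ring_norm = ring_seminorm +
  assumes nrm_eq_zero: "\<lbrakk>f \<in> carrier R; nrm f = 0\<rbrakk> \<Longrightarrow> f = \<zero>"

locale seminormed_ring = ring_seminorm +
  assumes nrm_nontrivial: "\<exists>f\<in>carrier R. f \<noteq> \<zero> \<and> nrm f \<noteq> 1"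

definition power_multiplicative :: "('a, 'm) ring_scheme \<Rightarrow> ('a \<Rightarrow> real) \<Rightarrow> bool" where
  "power_multiplicative R \<phi> \<longleftrightarrow>
     (\<forall>f\<in>carrier R. \<forall>n::nat. \<phi> (f [^]\<^bsub>R\<^esub> n) = \<phi> f ^ n)"

definition bounded_seminorm ::
    "('a, 'm) ring_scheme \<Rightarrow> ('a \<Rightarrow> real) \<Rightarrow> ('a \<Rightarrow> real) \<Rightarrow> bool" where
  "bounded_seminorm R nrm \<phi> \<longleftrightarrow>
     ring_seminorm R \<phi> \<and> (\<exists>C>0. \<forall>f\<in>carrier R. \<phi> f \<le> C * nrm f)"

definition spectrally_reduced ::
    "('a, 'm) ring_scheme \<Rightarrow> ('a \<Rightarrow> real) \<Rightarrow> 'a set \<Rightarrow> bool" where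
  "spectrally_reduced R nrm J \<longleftrightarrow>
     ideal J R \<and> J \<noteq> carrier R \<and>
     (\<exists>\<phi>. bounded_seminorm R nrm \<phi> \<and> power_multiplicative R \<phi> \<and>
          J = {f \<in> carrier R. \<phi> f = 0})"

text \<open>The metric induced by a norm. It is set to 0 off the carrier because
  \<^locale>\<open>Metric_space\<close> demands nonnegativity and symmetry on the whole type.\<close>

definition norm_dist :: "('a, 'm) ring_scheme \<Rightarrow> ('a \<Rightarrow> real) \<Rightarrow> 'a \<Rightarrow> 'a \<Rightarrow> real" where
  "norm_dist R nrm x y =
     (if x \<in> carrier R \<and> y \<in> carrier R then nrm (x \<ominus>\<^bsub>R\<^esub> y) else 0)"

definition norm_complete :: "('a, 'm) ring_scheme \<Rightarrow> ('a \<Rightarrow> real) \<Rightarrow> bool" where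
  "norm_complete R nrm \<longleftrightarrow> Metric_space.mcomplete (carrier R) (norm_dist R nrm)"

lemma (in ring_norm) Metric_space_norm_dist: "Metric_space (carrier R) (norm_dist R nrm)"
proof
  fix x y
  show "0 \<le> norm_dist R nrm x y"
    by (simp add: norm_dist_def nrm_nonneg)
  have "y \<ominus> x = \<ominus> (x \<ominus> y)" if "x \<in> carrier R" "y \<in> carrier R"
    using that by (simp add: minus_eq minus_add a_comm)
  then show "norm_dist R nrm x y = norm_dist R nrm y x"
    by (auto simp: norm_dist_def nrm_minus)
next
  fix x y assume xy: "x \<in> carrier R" "y \<in> carrier R"
  then show "norm_dist R nrm x y = 0 \<longleftrightarrow> x = y"
    by (metis norm_dist_def minus_closed nrm_eq_zero nrm_zero r_right_minus_eq)
next
  fix x y z assume xyz: "x \<in> carrier R" "y \<in> carrier R" "z \<in> carrier R"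
  have "x \<ominus> z = (x \<ominus> y) \<oplus> (y \<ominus> z)"
    using xyz by (simp add: minus_eq a_assoc r_neg1 r_neg2)
  then have "nrm (x \<ominus> z) \<le> max (nrm (x \<ominus> y)) (nrm (y \<ominus> z))"
    using xyz by (simp add: nrm_add)
  moreover have "0 \<le> nrm (x \<ominus> y)" "0 \<le> nrm (y \<ominus> z)"
    using xyz by (simp_all add: nrm_nonneg)
  ultimately show "norm_dist R nrm x z \<le> norm_dist R nrm x y + norm_dist R nrm y z"
    using xyz by (simp add: norm_dist_def)
qed

locale nonarchimedean_field = field K for K :: "('k, 'l) ring_scheme" (structure) and absv :: "'k \<Rightarrow> real" +
  assumes absv_nonneg: "x \<in> carrier K \<Longrightarrow> 0 \<le> absv x"
    and absv_eq_zero: "x \<in> carrier K \<Longrightarrow> absv x = 0 \<longleftrightarrow> x = \<zero>"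
    and absv_mult: "\<lbrakk>x \<in> carrier K; y \<in> carrier K\<rbrakk> \<Longrightarrow> absv (x \<otimes> y) = absv x * absv y"
    and absv_add: "\<lbrakk>x \<in> carrier K; y \<in> carrier K\<rbrakk> \<Longrightarrow> absv (x \<oplus> y) \<le> max (absv x) (absv y)"
    and absv_nontrivial: "\<exists>x\<in>carrier K. x \<noteq> \<zero> \<and> absv x \<noteq> 1"
    and absv_complete: "norm_complete K absv"

locale banach_algebra =
  K?: nonarchimedean_field K absv + algebra K A + N?: ring_norm A nrm
  for K :: "('k, 'l) ring_scheme" (structure) and absv :: "'k \<Rightarrow> real"
    and A :: "('k, 'a, 'n) module_scheme" (structure) and nrm :: "'a \<Rightarrow> real" +
  assumes nrm_smult:
      "\<lbrakk>c \<in> carrier K; f \<in> carrier A\<rbrakk> \<Longrightarrow> nrm (c \<odot>\<^bsub>A\<^esub> f) = absv c * nrm f"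
    and nrm_complete: "norm_complete A nrm"

lemma banach_algebra_imp_seminormed_ring:
  assumes "banach_algebra K absv A nrm"
  shows "seminormed_ring A nrm"
proof -
  interpret banach_algebra K absv A nrm by fact
  obtain c where c: "c \<in> carrier K" "c \<noteq> \<zero>\<^bsub>K\<^esub>" "absv c \<noteq> 1"
    using absv_nontrivial by blast
  let ?f = "c \<odot>\<^bsub>A\<^esub> \<one>\<^bsub>A\<^esub>"
  have f: "?f \<in> carrier A" "nrm ?f = absv c"
    using c by (simp_all add: nrm_smult N.nrm_one)
  moreover have "?f \<noteq> \<zero>\<^bsub>A\<^esub>"
    using c f by (metis absv_eq_zero N.nrm_zero)
  ultimately show ?thesis
    using c by unfold_locales auto
qed

definition radical :: "('a, 'm) ring_scheme \<Rightarrow> 'a set \<Rightarrow> 'a set" where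
  "radical R J = {f \<in> carrier R. \<exists>n::nat. n > 0 \<and> f [^]\<^bsub>R\<^esub> n \<in> J}"

definition radical_ideal :: "('a, 'm) ring_scheme \<Rightarrow> 'a set \<Rightarrow> bool" where
  "radical_ideal R J \<longleftrightarrow> ideal J R \<and> radical R J = J"

definition Spec :: "('a, 'm) ring_scheme \<Rightarrow> 'a set set" where
  "Spec R = {p. primeideal p R}"

definition zariski_closed :: "('a, 'm) ring_scheme \<Rightarrow> 'a set \<Rightarrow> 'a set set" where
  "zariski_closed R E = {p \<in> Spec R. E \<subseteq> p}"

definition zariski_topology :: "('a, 'm) ring_scheme \<Rightarrow> 'a set topology" where
  "zariski_topology R =
     topology (\<lambda>U. \<exists>E. E \<subseteq> carrier R \<and> U = Spec R - zariski_closed R E)"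

lemma istopology_zariski:
  "istopology (\<lambda>U. \<exists>E. E \<subseteq> carrier R \<and> U = Spec R - zariski_closed R E)"
  unfolding istopology_def
proof (intro conjI allI impI)
  fix S T
  assume "\<exists>E. E \<subseteq> carrier R \<and> S = Spec R - zariski_closed R E"
    and "\<exists>E. E \<subseteq> carrier R \<and> T = Spec R - zariski_closed R E"
  then obtain E F where
    E: "E \<subseteq> carrier R" "S = Spec R - zariski_closed R E" and
    F: "F \<subseteq> carrier R" "T = Spec R - zariski_closed R F"
    by blast
  let ?G = "{e \<otimes>\<^bsub>R\<^esub> f | e f. e \<in> E \<and> f \<in> F}"
  have mem: "?G \<subseteq> p \<longleftrightarrow> E \<subseteq> p \<or> F \<subseteq> p" if "p \<in> Spec R" for p
  proof -
    interpret primeideal p R using that by (simp add: Spec_def)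
    show ?thesis
    proof
      assume G: "?G \<subseteq> p"
      show "E \<subseteq> p \<or> F \<subseteq> p"
      proof (rule ccontr)
        assume "\<not> (E \<subseteq> p \<or> F \<subseteq> p)"
        then obtain e f where ef: "e \<in> E" "e \<notin> p" "f \<in> F" "f \<notin> p" by blast
        then have "e \<otimes>\<^bsub>R\<^esub> f \<in> p" using G by blast
        then show False using I_prime ef E(1) F(1) by blast
      qed
    next
      assume "E \<subseteq> p \<or> F \<subseteq> p"
      then show "?G \<subseteq> p" using E(1) F(1) I_l_closed I_r_closed by blast
    qed
  qed
  have "?G \<subseteq> carrier R" if "p \<in> Spec R" for p
  proof -
    interpret primeideal p R using that by (simp add: Spec_def)
    show ?thesis using E(1) F(1) by blast
  qed
  moreover have "S \<inter> T = Spec R - zariski_closed R ?G"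
  proof (rule Set.set_eqI)
    fix p
    show "p \<in> S \<inter> T \<longleftrightarrow> p \<in> Spec R - zariski_closed R ?G"
    proof (cases "p \<in> Spec R")
      case True
      then show ?thesis
        unfolding E(2) F(2) zariski_closed_def Diff_iff Int_iff mem_Collect_eq mem[OF True] by blast
    next
      case False
      then show ?thesis by (simp add: E(2))
    qed
  qed
  ultimately show "\<exists>E. E \<subseteq> carrier R \<and> S \<inter> T = Spec R - zariski_closed R E"
  proof (cases "Spec R = {}")
    case True
    then show ?thesis by (intro exI[of _ E] conjI E(1)) (simp add: E(2))
  next
    case False
    then obtain p where "p \<in> Spec R" by blast
    with \<open>S \<inter> T = _\<close> \<open>\<And>p. p \<in> Spec R \<Longrightarrow> ?G \<subseteq> carrier R\<close> show ?thesis
      by (intro exI[of _ ?G] conjI) simp_all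
  qed
next
  fix \<K>
  assume "\<forall>S\<in>\<K>. \<exists>E. E \<subseteq> carrier R \<and> S = Spec R - zariski_closed R E"
  then obtain E where E: "\<And>S. S \<in> \<K> \<Longrightarrow> E S \<subseteq> carrier R \<and> S = Spec R - zariski_closed R (E S)"
    by metis
  have "\<Union>\<K> = Spec R - zariski_closed R (\<Union>S\<in>\<K>. E S)"
  proof (intro equalityI subsetI)
    fix p assume "p \<in> \<Union>\<K>"
    then obtain S where "S \<in> \<K>" "p \<in> S" by blast
    with E[of S] show "p \<in> Spec R - zariski_closed R (\<Union>S\<in>\<K>. E S)"
      by (auto simp: zariski_closed_def)
  next
    fix p assume "p \<in> Spec R - zariski_closed R (\<Union>S\<in>\<K>. E S)"
    then obtain S where S: "S \<in> \<K>" "p \<in> Spec R" "\<not> E S \<subseteq> p"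
      by (auto simp: zariski_closed_def)
    then have "p \<in> Spec R - zariski_closed R (E S)"
      by (simp add: zariski_closed_def)
    with S E show "p \<in> \<Union>\<K>" by blast
  qed
  moreover have "(\<Union>S\<in>\<K>. E S) \<subseteq> carrier R" using E by blast
  ultimately show "\<exists>E. E \<subseteq> carrier R \<and> \<Union>\<K> = Spec R - zariski_closed R E" by blast
qed

lemma openin_zariski:
  "openin (zariski_topology R) U \<longleftrightarrow>
     (\<exists>E. E \<subseteq> carrier R \<and> U = Spec R - zariski_closed R E)"
  unfolding zariski_topology_def by (simp add: topology_inverse'[OF istopology_zariski])

lemma topspace_zariski: "topspace (zariski_topology R) = Spec R"
proof
  show "topspace (zariski_topology R) \<subseteq> Spec R"
    using openin_topspace[of "zariski_topology R"] unfolding openin_zariski by blast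
  have "zariski_closed R (carrier R) = {}"
    using primeideal.I_notcarr additive_subgroup.a_subset
    by (fastforce simp: zariski_closed_def Spec_def primeideal_def ideal_def primeideal_axioms_def)
  then have "openin (zariski_topology R) (Spec R)"
    unfolding openin_zariski by auto
  then show "Spec R \<subseteq> topspace (zariski_topology R)"
    by (rule openin_subset)
qed

definition Spec_Top :: "('a, 'm) ring_scheme \<Rightarrow> ('a \<Rightarrow> real) \<Rightarrow> 'a set topology" where
  "Spec_Top R nrm =
     subtopology (zariski_topology R) {p \<in> Spec R. spectrally_reduced R nrm p}"

definition irreducible_in :: "'a topology \<Rightarrow> 'a set \<Rightarrow> bool" where
  "irreducible_in X Z \<longleftrightarrow>
     Z \<subseteq> topspace X \<and> Z \<noteq> {} \<and>
     (\<forall>A B. closedin X A \<and> closedin X B \<and> Z \<subseteq> A \<union> B \<longrightarrow> Z \<subseteq> A \<or> Z \<subseteq> B)"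

definition sober_space :: "'a topology \<Rightarrow> bool" where
  "sober_space X \<longleftrightarrow>
     (\<forall>Z. closedin X Z \<and> irreducible_in X Z \<longrightarrow>
        (\<exists>!x. x \<in> topspace X \<and> X closure_of {x} = Z))"

end

theory Submission
  imports Defs "HOL-Analysis.Urysohn"
begin

text \<open>
  Two seminorms attached to an ideal \<open>J\<close> of a seminormed ring carry the whole argument: the quotient
  seminorm \<open>q f = inf \<bar>f + j\<bar>\<close> over \<open>j \<in> J\<close>, and the spectral seminorm \<open>\<rho>\<close> of \<open>q\<close>, the exponential
  growth rate of \<open>q (f ^ n)\<close>.  As soon as no element of \<open>J\<close> lies at distance less than 1 from \<open>\<one>\<close>, both
  are seminorms with value 1 at \<open>\<one>\<close>, and \<open>\<rho>\<close> is power-multiplicative and bounded by the given seminorm.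
  So \<open>J\<close> is spectrally reduced once \<open>\<rho>\<close> vanishes on \<open>J\<close> only (lemma \<open>spectrally_reducedI\<close>).
  Conversely a power-multiplicative bounded seminorm \<open>\<phi>\<close> is bounded with constant 1, since
  \<open>(\<phi> f) ^ n = \<phi> (f ^ n) \<le> C \<bar>f\<bar> ^ n\<close> for all \<open>n\<close>; hence spectrally reduced ideals stay at
  distance at least 1 from \<open>\<one>\<close>.

  Quasi-compactness.  The open unit ball \<open>S\<close> around \<open>\<one>\<close> is multiplicatively closed, so an ideal that
  misses \<open>S\<close> lies in a prime \<open>P\<close> that is maximal among the ideals missing \<open>S\<close>.  The kernel of \<open>\<rho>\<close> for
  \<open>P\<close> is again an ideal missing \<open>S\<close>, so it equals \<open>P\<close>, and \<open>P\<close> is spectrally reduced.  For a family of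
  closed sets with the finite intersection property this is applied to the ideal of all elements that
  vanish on some finite intersection.

  Sobriety.  A pointwise supremum of power-multiplicative seminorms bounded by the given one is again
  such a seminorm, so intersections of spectrally reduced ideals are spectrally reduced.  For an
  irreducible closed \<open>Z\<close> the ideal \<open>\<Inter>Z\<close> is also prime, and it is the generic point.

  Noetherian Banach algebras.  A radical ideal is an intersection of primes, so it is enough to treat a
  prime \<open>P\<close>.  The Baire category theorem shows that a closed ideal with finitely many generators is
  generated with bounded coefficients, which is the open mapping theorem for the map from coefficients
  to linear combinations.  Applied to the closure of an ideal, this shows that every ideal is closed:
  generators of the closure may be replaced by close elements of the ideal.  Applied to the closed
  ideal \<open>P + (f)\<close> with \<open>f \<notin> P\<close>, it gives \<open>q g \<le> C * q (f * g)\<close>, because multiplication by \<open>f\<close> is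
  injective modulo \<open>P\<close>.  Iterating, \<open>1 \<le> C ^ n * q (f ^ n)\<close>, so \<open>\<rho> f \<ge> 1 / C > 0\<close>.  Thus \<open>\<rho>\<close> vanishes
  on \<open>P\<close> only.
\<close>

section \<open>Primes that avoid a multiplicative set\<close>

lemma (in cring) ideal_elementwiseI:
  assumes "I \<subseteq> carrier R" "\<zero> \<in> I"
    and add: "\<And>x y. x \<in> I \<Longrightarrow> y \<in> I \<Longrightarrow> x \<oplus> y \<in> I"
    and mult: "\<And>r x. r \<in> carrier R \<Longrightarrow> x \<in> I \<Longrightarrow> r \<otimes> x \<in> I"
  shows "ideal I R"
proof (rule idealI[OF ring_axioms])
  have neg: "\<ominus> x \<in> I" if "x \<in> I" for x
    using mult[of "\<ominus> \<one>" x] that assms(1) l_minus[of \<one> x] by auto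
  show "subgroup I (add_monoid R)"
    using assms neg by (intro add.subgroupI) auto
  show "x \<otimes> a \<in> I" if "a \<in> I" "x \<in> carrier R" for a x
    using that by (rule mult[rotated])
  show "a \<otimes> x \<in> I" if "a \<in> I" "x \<in> carrier R" for a x
    using mult[of x a] that assms(1) by (simp add: m_comm subset_iff)
qed

lemma (in cring) ideal_adjoin:
  assumes P: "ideal P R" and a: "a \<in> carrier R"
  shows "ideal {p \<oplus> r \<otimes> a | p r. p \<in> P \<and> r \<in> carrier R} R"
    and "P \<subseteq> {p \<oplus> r \<otimes> a | p r. p \<in> P \<and> r \<in> carrier R}"
    and "a \<in> {p \<oplus> r \<otimes> a | p r. p \<in> P \<and> r \<in> carrier R}"
proof -
  interpret P: ideal P R by (rule P)
  let ?I = "{p \<oplus> r \<otimes> a | p r. p \<in> P \<and> r \<in> carrier R}"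
  have mem: "x \<in> ?I" if "p \<in> P" "r \<in> carrier R" "x = p \<oplus> r \<otimes> a" for x p r
    using that by blast
  show "ideal ?I R"
  proof (rule ideal_elementwiseI)
    show "?I \<subseteq> carrier R"
      using a P.Icarr by auto
    show "\<zero> \<in> ?I"
      by (rule mem[of \<zero> \<zero>]) (use a in auto)
  next
    fix x y assume "x \<in> ?I" "y \<in> ?I"
    then obtain p r q s where "p \<in> P" "r \<in> carrier R" "x = p \<oplus> r \<otimes> a"
      and "q \<in> P" "s \<in> carrier R" "y = q \<oplus> s \<otimes> a"
      by blast
    then show "x \<oplus> y \<in> ?I"
      using a P.Icarr by (intro mem[of "p \<oplus> q" "r \<oplus> s"]) (auto simp: l_distr a_ac)
  next
    fix t x assume t: "t \<in> carrier R" and "x \<in> ?I"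
    then obtain p r where "p \<in> P" "r \<in> carrier R" "x = p \<oplus> r \<otimes> a"
      by blast
    then show "t \<otimes> x \<in> ?I"
      using a t P.Icarr P.I_l_closed by (intro mem[of "t \<otimes> p" "t \<otimes> r"]) (auto simp: r_distr m_ac)
  qed
  show "P \<subseteq> ?I"
    using a P.Icarr by (intro subsetI, rule_tac mem[of _ \<zero>]) auto
  show "a \<in> ?I"
    by (rule mem[of \<zero> \<one>]) (use a in auto)
qed

text \<open>Zorn's lemma gives an ideal \<open>P\<close> maximal among those disjoint from \<open>S\<close>.  If \<open>a\<close> and \<open>b\<close> lie outside
  \<open>P\<close>, then \<open>P + (a)\<close> and \<open>P + (b)\<close> meet \<open>S\<close>, and so does their product, which is contained in
  \<open>P + (ab)\<close>; hence \<open>ab \<notin> P\<close>.  The maximality of \<open>P\<close> is kept in the conclusion because it identifies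
  \<open>P\<close> with the kernel of a seminorm later on.\<close>

lemma (in cring) prime_disjoint_from_multiplicative_set:
  assumes J: "ideal J R" and disj: "J \<inter> S = {}"
    and S: "S \<subseteq> carrier R" "\<one> \<in> S" and mult: "\<And>s t. s \<in> S \<Longrightarrow> t \<in> S \<Longrightarrow> s \<otimes> t \<in> S"
  obtains P where "primeideal P R" "J \<subseteq> P" "P \<inter> S = {}"
    "\<And>I. ideal I R \<Longrightarrow> P \<subseteq> I \<Longrightarrow> I \<inter> S = {} \<Longrightarrow> I = P"
proof -
  define \<A> where "\<A> = {I. ideal I R \<and> J \<subseteq> I \<and> I \<inter> S = {}}"
  have "\<exists>P\<in>\<A>. \<forall>I\<in>\<A>. P \<subseteq> I \<longrightarrow> I = P"
  proof (rule subset_Zorn_nonempty)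
    show "\<A> \<noteq> {}"
      using J disj by (auto simp: \<A>_def)
  next
    fix C assume C: "C \<noteq> {}" "subset.chain \<A> C"
    then have "subset.chain {I. ideal I R} C"
      by (auto simp: \<A>_def pred_on.chain_def)
    from chain_Union_is_ideal[OF this] C(1) have ideal: "ideal (\<Union>C) R"
      by simp
    have "\<And>I. I \<in> C \<Longrightarrow> J \<subseteq> I \<and> I \<inter> S = {}"
      using C(2) by (auto simp: \<A>_def pred_on.chain_def)
    then have "J \<subseteq> \<Union>C" "\<Union>C \<inter> S = {}"
      using C(1) by blast+
    with ideal show "\<Union>C \<in> \<A>"
      by (simp add: \<A>_def)
  qed
  then obtain P where P: "ideal P R" "J \<subseteq> P" "P \<inter> S = {}"
    and max': "\<And>I. I \<in> \<A> \<Longrightarrow> P \<subseteq> I \<Longrightarrow> I = P"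
    by (auto simp: \<A>_def)
  have max: "I = P" if "ideal I R" "P \<subseteq> I" "I \<inter> S = {}" for I
    using that P(2) by (intro max') (auto simp: \<A>_def)
  interpret P: ideal P R by (rule P)
  have meets: "\<exists>p\<in>P. \<exists>r\<in>carrier R. p \<oplus> r \<otimes> a \<in> S" if a: "a \<in> carrier R" "a \<notin> P" for a
  proof (rule ccontr)
    assume "\<not> ?thesis"
    then have "{p \<oplus> r \<otimes> a | p r. p \<in> P \<and> r \<in> carrier R} \<inter> S = {}"
      by blast
    from max[OF ideal_adjoin(1,2)[OF P(1) a(1)] this] ideal_adjoin(3)[OF P(1) a(1)] a(2)
    show False by simp
  qed
  have "primeideal P R"
  proof (rule primeidealI[OF P(1) is_cring])
    show "carrier R \<noteq> P"
      using P(3) S by blast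
  next
    fix a b assume ab: "a \<in> carrier R" "b \<in> carrier R" "a \<otimes> b \<in> P"
    show "a \<in> P \<or> b \<in> P"
    proof (rule ccontr)
      assume "\<not> (a \<in> P \<or> b \<in> P)"
      then have "a \<notin> P" "b \<notin> P" by auto
      then obtain p r q s where pr: "p \<in> P" "r \<in> carrier R" "p \<oplus> r \<otimes> a \<in> S"
        and qs: "q \<in> P" "s \<in> carrier R" "q \<oplus> s \<otimes> b \<in> S"
        using meets[OF ab(1)] meets[OF ab(2)] by blast
      have carr: "p \<in> carrier R" "q \<in> carrier R"
        using pr qs P.Icarr by auto
      have "(p \<oplus> r \<otimes> a) \<otimes> (q \<oplus> s \<otimes> b) = ((q \<oplus> s \<otimes> b) \<otimes> p \<oplus> (r \<otimes> a) \<otimes> q) \<oplus> (r \<otimes> s) \<otimes> (a \<otimes> b)"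
        using carr pr(2) qs(2) ab by algebra
      also have "\<dots> \<in> P"
        using carr pr(2,3) qs(2,3) ab S(1)
        by (intro P.a_closed P.I_l_closed[OF pr(1)] P.I_l_closed[OF qs(1)] P.I_l_closed[OF ab(3)]) auto
      finally show False
        using mult[OF pr(3) qs(3)] P(3) by blast
    qed
  qed
  then show ?thesis
    using that P max by blast
qed

section \<open>Quotient seminorms and spectral seminorms\<close>

definition quotient_seminorm :: "('a, 'm) ring_scheme \<Rightarrow> ('a \<Rightarrow> real) \<Rightarrow> 'a set \<Rightarrow> 'a \<Rightarrow> real" where
  "quotient_seminorm R nrm J f = (INF j\<in>J. nrm (f \<oplus>\<^bsub>R\<^esub> j))"

text \<open>The infimum of these rates is the spectral radius \<open>lim \<bar>f ^ n\<bar> powr (1/n)\<close>.  Working with rates and an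
  arbitrary constant \<open>C\<close> avoids the existence of that limit, and makes sums and products of elements
  a matter of multiplying constants.\<close>

definition growth_rates :: "('a, 'm) ring_scheme \<Rightarrow> ('a \<Rightarrow> real) \<Rightarrow> 'a \<Rightarrow> real set" where
  "growth_rates R nrm f = {s. s > 0 \<and> (\<exists>C. \<forall>n::nat. nrm (f [^]\<^bsub>R\<^esub> n) \<le> C * s ^ n)}"

definition spectral_seminorm :: "('a, 'm) ring_scheme \<Rightarrow> ('a \<Rightarrow> real) \<Rightarrow> 'a \<Rightarrow> real" where
  "spectral_seminorm R nrm f = Inf (growth_rates R nrm f)"

lemma le_mult_if_le_enlarged:
  fixes a b x :: real
  assumes "\<And>e. e > 0 \<Longrightarrow> x \<le> (a + e) * (b + e)"
  shows "x \<le> a * b"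
proof (rule tendsto_lowerbound)
  show "((\<lambda>e. (a + e) * (b + e)) \<longlongrightarrow> a * b) (at_right 0)"
    by (auto intro!: tendsto_eq_intros)
  show "\<forall>\<^sub>F e in at_right 0. x \<le> (a + e) * (b + e)"
    using eventually_at_right_less[of "0::real"] by eventually_elim (rule assms)
qed simp

lemma le_if_powers_le_const_mult:
  fixes a b C :: real
  assumes le: "\<And>n::nat. a ^ n \<le> C * b ^ n" and nonneg: "0 \<le> a" "0 \<le> b"
  shows "a \<le> b"
proof (rule ccontr)
  assume "\<not> a \<le> b"
  show False
  proof (cases "b = 0")
    case True
    then show False
      using le[of 1] nonneg \<open>\<not> a \<le> b\<close> by simp
  next
    case False
    then have "b > 0" "a / b > 1"
      using nonneg \<open>\<not> a \<le> b\<close> by auto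
    then obtain n where "C < (a / b) ^ n"
      using real_arch_pow by blast
    with le[of n] \<open>b > 0\<close> show False
      by (simp add: power_divide field_simps)
  qed
qed

context ring_seminorm
begin

lemma nrm_diff: "f \<in> carrier R \<Longrightarrow> g \<in> carrier R \<Longrightarrow> nrm (f \<ominus> g) \<le> max (nrm f) (nrm g)"
  using nrm_add[of f "\<ominus> g"] by (simp add: minus_eq nrm_minus)

lemma nrm_pow_le: "f \<in> carrier R \<Longrightarrow> nrm (f [^] n) \<le> nrm f ^ n" for n :: nat
proof (induction n)
  case (Suc n)
  have "nrm (f [^] Suc n) \<le> nrm (f [^] n) * nrm f"
    using Suc.prems by (simp add: nrm_mult)
  also have "\<dots> \<le> nrm f ^ n * nrm f"
    using Suc by (intro mult_right_mono nrm_nonneg) auto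
  finally show ?case by (simp add: mult.commute)
qed (simp add: nrm_one)

lemma quotient_seminorm_le:
  assumes "ideal J R" "f \<in> carrier R" "j \<in> J"
  shows "quotient_seminorm R nrm J f \<le> nrm (f \<oplus> j)"
  unfolding quotient_seminorm_def
proof (rule cINF_lower)
  show "bdd_below ((\<lambda>j. nrm (f \<oplus> j)) ` J)"
    using assms ideal.Icarr[OF assms(1)] by (intro bdd_belowI[of _ 0]) (auto intro: nrm_nonneg)
qed (fact assms)

lemma quotient_seminorm_nearly_attained:
  assumes "ideal J R" "quotient_seminorm R nrm J f < t"
  obtains j where "j \<in> J" "nrm (f \<oplus> j) < t"
proof -
  have "J \<noteq> {}"
    using assms(1) by (meson additive_subgroup.zero_closed empty_iff ideal.axioms(1))
  then have "\<exists>x\<in>(\<lambda>j. nrm (f \<oplus> j)) ` J. x < t"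
    using assms(2) unfolding quotient_seminorm_def by (intro cInf_lessD) auto
  then show ?thesis
    using that by blast
qed

lemma quotient_seminorm_nonneg:
  assumes "ideal J R" "f \<in> carrier R"
  shows "0 \<le> quotient_seminorm R nrm J f"
proof (rule ccontr)
  assume "\<not> ?thesis"
  then obtain j where "j \<in> J" "nrm (f \<oplus> j) < 0"
    using quotient_seminorm_nearly_attained[OF assms(1), of f 0] by auto
  then show False
    using nrm_nonneg[of "f \<oplus> j"] assms ideal.Icarr[OF assms(1)] by auto
qed

lemma quotient_seminorm_le_nrm:
  assumes "ideal J R" "f \<in> carrier R"
  shows "quotient_seminorm R nrm J f \<le> nrm f"
  using quotient_seminorm_le[OF assms, of \<zero>] assms
  by (simp add: additive_subgroup.zero_closed ideal.axioms(1))

lemma quotient_seminorm_eq_0: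
  assumes "ideal J R" "f \<in> J"
  shows "quotient_seminorm R nrm J f = 0"
proof -
  interpret J: ideal J R by fact
  have "quotient_seminorm R nrm J f \<le> nrm (f \<oplus> \<ominus> f)"
    using assms J.Icarr by (intro quotient_seminorm_le) auto
  then show ?thesis
    using quotient_seminorm_nonneg[OF assms(1), of f] J.Icarr[OF assms(2)]
    by (simp add: r_neg nrm_zero)
qed

text \<open>The distance hypothesis is what yields the value 1 at \<open>\<one>\<close>; without it the quotient seminorm of
  \<open>\<one>\<close> can drop below 1.\<close>

lemma ring_seminorm_quotient:
  assumes J: "ideal J R" and far: "\<And>j. j \<in> J \<Longrightarrow> 1 \<le> nrm (\<one> \<ominus> j)"
  shows "ring_seminorm R (quotient_seminorm R nrm J)"
proof -
  interpret J: ideal J R by (rule J)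
  let ?q = "quotient_seminorm R nrm J"
  show ?thesis
  proof unfold_locales
    show "0 \<le> ?q f" if "f \<in> carrier R" for f
      by (rule quotient_seminorm_nonneg[OF J that])
    show "?q \<zero> = 0"
      by (rule quotient_seminorm_eq_0[OF J]) simp
    have "\<not> ?q \<one> < 1"
    proof
      assume "?q \<one> < 1"
      then obtain j where "j \<in> J" "nrm (\<one> \<oplus> j) < 1"
        by (rule quotient_seminorm_nearly_attained[OF J])
      then show False
        using far[of "\<ominus> j"] J.Icarr by (auto simp: minus_eq)
    qed
    then show "?q \<one> = 1"
      using quotient_seminorm_le_nrm[OF J, of \<one>] nrm_one by simp
  next
    fix f assume f: "f \<in> carrier R"
    have le: "?q (\<ominus> f) \<le> ?q f" if f: "f \<in> carrier R" for f
    proof (rule dense_ge)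
      fix t assume "?q f < t"
      then obtain j where j: "j \<in> J" "nrm (f \<oplus> j) < t"
        by (rule quotient_seminorm_nearly_attained[OF J])
      have "?q (\<ominus> f) \<le> nrm (\<ominus> f \<oplus> \<ominus> j)"
        using f j by (intro quotient_seminorm_le[OF J]) auto
      also have "\<ominus> f \<oplus> \<ominus> j = \<ominus> (f \<oplus> j)"
        using f J.Icarr[OF j(1)] by (simp add: minus_add)
      finally show "?q (\<ominus> f) \<le> t"
        using j f J.Icarr[OF j(1)] by (simp add: nrm_minus)
    qed
    show "?q (\<ominus> f) = ?q f"
      using le[OF f] le[of "\<ominus> f"] f by simp
  next
    fix f g assume fg: "f \<in> carrier R" "g \<in> carrier R"
    show "?q (f \<oplus> g) \<le> max (?q f) (?q g)"
    proof (rule dense_ge)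
      fix t assume t: "max (?q f) (?q g) < t"
      obtain j where j: "j \<in> J" "nrm (f \<oplus> j) < t"
        using t quotient_seminorm_nearly_attained[OF J, of f t] by auto
      obtain k where k: "k \<in> J" "nrm (g \<oplus> k) < t"
        using t quotient_seminorm_nearly_attained[OF J, of g t] by auto
      note c = J.Icarr[OF j(1)] J.Icarr[OF k(1)]
      have "?q (f \<oplus> g) \<le> nrm (f \<oplus> g \<oplus> (j \<oplus> k))"
        using fg j k by (intro quotient_seminorm_le[OF J]) auto
      also have "f \<oplus> g \<oplus> (j \<oplus> k) = (f \<oplus> j) \<oplus> (g \<oplus> k)"
        using fg c by algebra
      also have "nrm \<dots> \<le> max (nrm (f \<oplus> j)) (nrm (g \<oplus> k))"
        using fg c by (intro nrm_add) auto
      finally show "?q (f \<oplus> g) \<le> t"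
        using j k by simp
    qed
    show "?q (f \<otimes> g) \<le> ?q f * ?q g"
    proof (rule le_mult_if_le_enlarged)
      fix e :: real assume e: "e > 0"
      obtain j where j: "j \<in> J" "nrm (f \<oplus> j) < ?q f + e"
        by (rule quotient_seminorm_nearly_attained[OF J, of f "?q f + e"]) (use e in auto)
      obtain k where k: "k \<in> J" "nrm (g \<oplus> k) < ?q g + e"
        by (rule quotient_seminorm_nearly_attained[OF J, of g "?q g + e"]) (use e in auto)
      note c = J.Icarr[OF j(1)] J.Icarr[OF k(1)]
      have "?q (f \<otimes> g) \<le> nrm (f \<otimes> g \<oplus> (f \<otimes> k \<oplus> (g \<oplus> k) \<otimes> j))"
        using fg j k c by (intro quotient_seminorm_le[OF J] J.a_closed J.I_l_closed) auto
      also have "f \<otimes> g \<oplus> (f \<otimes> k \<oplus> (g \<oplus> k) \<otimes> j) = (f \<oplus> j) \<otimes> (g \<oplus> k)"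
        using fg c by algebra
      also have "nrm \<dots> \<le> nrm (f \<oplus> j) * nrm (g \<oplus> k)"
        using fg c by (intro nrm_mult) auto
      also have "\<dots> \<le> (?q f + e) * (?q g + e)"
        using j k fg c nrm_nonneg[of "f \<oplus> j"] by (intro mult_mono nrm_nonneg) auto
      finally show "?q (f \<otimes> g) \<le> (?q f + e) * (?q g + e)" .
    qed
  qed
qed

lemma growth_rate_if_nrm_le:
  assumes "f \<in> carrier R" "nrm f \<le> s" "0 < s"
  shows "s \<in> growth_rates R nrm f"
proof -
  have "nrm (f [^] n) \<le> 1 * s ^ n" for n :: nat
    using nrm_pow_le[OF assms(1), of n] power_mono[OF assms(2) nrm_nonneg[OF assms(1)], of n] by simp
  then show ?thesis
    using assms(3) unfolding growth_rates_def by blast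
qed

lemma spectral_seminorm_le:
  assumes "s \<in> growth_rates R nrm f"
  shows "spectral_seminorm R nrm f \<le> s"
  unfolding spectral_seminorm_def using assms
  by (intro cInf_lower bdd_belowI[of _ 0]) (auto simp: growth_rates_def)

lemma growth_rate_below:
  assumes "f \<in> carrier R" "spectral_seminorm R nrm f < t"
  obtains s where "s \<in> growth_rates R nrm f" "s < t"
proof -
  have "growth_rates R nrm f \<noteq> {}"
    using growth_rate_if_nrm_le[OF assms(1), of "nrm f + 1"] nrm_nonneg[OF assms(1)] by auto
  then show ?thesis
    using assms(2) that unfolding spectral_seminorm_def by (metis cInf_lessD)
qed

lemma spectral_seminorm_nonneg:
  assumes "f \<in> carrier R"
  shows "0 \<le> spectral_seminorm R nrm f"
proof (rule ccontr)
  assume "\<not> ?thesis"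
  then obtain s where "s \<in> growth_rates R nrm f" "s < 0"
    using growth_rate_below[OF assms, of 0] by auto
  then show False by (simp add: growth_rates_def)
qed

lemma spectral_seminorm_le_nrm:
  assumes "f \<in> carrier R"
  shows "spectral_seminorm R nrm f \<le> nrm f"
proof (rule dense_ge)
  fix t assume "nrm f < t"
  then show "spectral_seminorm R nrm f \<le> t"
    using assms nrm_nonneg[OF assms] by (intro spectral_seminorm_le growth_rate_if_nrm_le) auto
qed

lemma growth_rateE:
  assumes "f \<in> carrier R" "s \<in> growth_rates R nrm f"
  obtains C where "C \<ge> 0" "\<And>n::nat. nrm (f [^] n) \<le> C * s ^ n" "s > 0"
proof -
  obtain C where C: "\<And>n::nat. nrm (f [^] n) \<le> C * s ^ n" "s > 0"
    using assms(2) by (auto simp: growth_rates_def)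
  have "C \<ge> 0"
    using C(1)[of 0] by (simp add: nrm_one)
  with C that show ?thesis by blast
qed

text \<open>The binomial expansion is replaced by an induction on the claim for all
  \<open>f ^ i * g ^ j * (f + g) ^ n\<close> simultaneously: splitting off one factor \<open>f + g\<close> raises \<open>i\<close> or \<open>j\<close>, and
  the ultrametric inequality loses nothing.\<close>

lemma growth_rate_add:
  assumes fg: "f \<in> carrier R" "g \<in> carrier R"
    and s: "s \<in> growth_rates R nrm f" "s \<in> growth_rates R nrm g"
  shows "s \<in> growth_rates R nrm (f \<oplus> g)"
proof -
  obtain C where C: "C \<ge> 0" "\<And>n::nat. nrm (f [^] n) \<le> C * s ^ n" "s > 0"
    by (rule growth_rateE[OF fg(1) s(1)]) (rule that)
  obtain D where D: "D \<ge> 0" "\<And>n::nat. nrm (g [^] n) \<le> D * s ^ n" "s > 0"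
    by (rule growth_rateE[OF fg(2) s(2)]) (rule that)
  have "nrm (f [^] i \<otimes> g [^] j \<otimes> (f \<oplus> g) [^] n) \<le> C * D * s ^ (i + j + n)" for i j n :: nat
  proof (induction n arbitrary: i j)
    case 0
    have "nrm (f [^] i \<otimes> g [^] j) \<le> nrm (f [^] i) * nrm (g [^] j)"
      using fg by (intro nrm_mult) auto
    also have "\<dots> \<le> (C * s ^ i) * (D * s ^ j)"
      using fg C D by (intro mult_mono nrm_nonneg) auto
    finally show ?case
      using fg by (simp add: power_add mult_ac)
  next
    case (Suc n)
    have carr: "f [^] i \<in> carrier R" "g [^] j \<in> carrier R" "(f \<oplus> g) [^] n \<in> carrier R"
      using fg by auto
    have split: "f [^] i \<otimes> g [^] j \<otimes> (f \<oplus> g) [^] Suc n =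
        f [^] Suc i \<otimes> g [^] j \<otimes> (f \<oplus> g) [^] n \<oplus> f [^] i \<otimes> g [^] Suc j \<otimes> (f \<oplus> g) [^] n"
      using fg carr unfolding nat_pow_Suc by algebra
    have "nrm (f [^] i \<otimes> g [^] j \<otimes> (f \<oplus> g) [^] Suc n) \<le>
        max (nrm (f [^] Suc i \<otimes> g [^] j \<otimes> (f \<oplus> g) [^] n)) (nrm (f [^] i \<otimes> g [^] Suc j \<otimes> (f \<oplus> g) [^] n))"
      unfolding split using fg by (intro nrm_add m_closed nat_pow_closed a_closed)
    \<comment> \<open>both summands have total exponent \<open>i + j + n + 1\<close>\<close>
    also have "\<dots> \<le> C * D * s ^ (i + j + Suc n)"
      using Suc.IH[of "Suc i" j] Suc.IH[of i "Suc j"] by simp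
    finally show ?case .
  qed
  from this[of 0 0] have "nrm ((f \<oplus> g) [^] n) \<le> C * D * s ^ n" for n :: nat
    using fg by simp
  with C(3) show ?thesis
    unfolding growth_rates_def by blast
qed

lemma growth_rate_mono:
  assumes "f \<in> carrier R" "s \<in> growth_rates R nrm f" "s \<le> t"
  shows "t \<in> growth_rates R nrm f"
proof -
  obtain C where C: "C \<ge> 0" "\<And>n::nat. nrm (f [^] n) \<le> C * s ^ n" "s > 0"
    by (rule growth_rateE[OF assms(1,2)]) (rule that)
  have "nrm (f [^] n) \<le> C * t ^ n" for n :: nat
    using C(2)[of n] mult_left_mono[OF power_mono[OF assms(3), of n] C(1)] C(3) by simp
  then show ?thesis
    using C(3) assms(3) unfolding growth_rates_def by auto
qed

lemma growth_rate_mult: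
  assumes fg: "f \<in> carrier R" "g \<in> carrier R"
    and s: "s \<in> growth_rates R nrm f" and t: "t \<in> growth_rates R nrm g"
  shows "s * t \<in> growth_rates R nrm (f \<otimes> g)"
proof -
  obtain C where C: "C \<ge> 0" "\<And>n::nat. nrm (f [^] n) \<le> C * s ^ n" "s > 0"
    by (rule growth_rateE[OF fg(1) s]) (rule that)
  obtain D where D: "D \<ge> 0" "\<And>n::nat. nrm (g [^] n) \<le> D * t ^ n" "t > 0"
    by (rule growth_rateE[OF fg(2) t]) (rule that)
  have "nrm ((f \<otimes> g) [^] n) \<le> (C * D) * (s * t) ^ n" for n :: nat
  proof -
    have "nrm ((f \<otimes> g) [^] n) \<le> nrm (f [^] n) * nrm (g [^] n)"
      using fg by (simp add: nat_pow_distrib nrm_mult)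
    also have "\<dots> \<le> (C * s ^ n) * (D * t ^ n)"
      using fg C D by (intro mult_mono nrm_nonneg) auto
    finally show ?thesis
      by (simp add: power_mult_distrib mult_ac)
  qed
  then show ?thesis
    using C(3) D(3) unfolding growth_rates_def by auto
qed

text \<open>Division with remainder writes \<open>f ^ n\<close> as a power of \<open>f ^ k\<close> times one of finitely many \<open>f ^ r\<close>, and
  these can be absorbed into the constant.\<close>

lemma growth_rate_root:
  assumes f: "f \<in> carrier R" and k: "k > 0" and s: "s > 0"
    and rate: "s ^ k \<in> growth_rates R nrm (f [^] k)"
  shows "s \<in> growth_rates R nrm f"
proof -
  obtain C where C: "C \<ge> 0" "\<And>n::nat. nrm ((f [^] k) [^] n) \<le> C * (s ^ k) ^ n" "s ^ k > 0"
    by (rule growth_rateE[OF nat_pow_closed[OF f] rate]) (rule that)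
  define D where "D = (\<Sum>r<k. nrm (f [^] r) / s ^ r)"
  have D: "nrm (f [^] r) \<le> D * s ^ r" if "r < k" for r
  proof -
    have "nrm (f [^] r) / s ^ r \<le> D"
      unfolding D_def using that f s
      by (intro member_le_sum) (auto intro!: divide_nonneg_pos nrm_nonneg)
    then show ?thesis
      using s by (simp add: field_simps)
  qed
  have "nrm (f [^] n) \<le> (C * D) * s ^ n" for n :: nat
  proof -
    have n: "n = k * (n div k) + n mod k" by simp
    have "f [^] n = (f [^] k) [^] (n div k) \<otimes> f [^] (n mod k)"
      using f by (subst n) (simp only: nat_pow_pow nat_pow_mult)
    then have "nrm (f [^] n) \<le> nrm ((f [^] k) [^] (n div k)) * nrm (f [^] (n mod k))"
      using f by (simp add: nrm_mult)
    also have "\<dots> \<le> (C * (s ^ k) ^ (n div k)) * (D * s ^ (n mod k))"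
      using f C s k by (intro mult_mono nrm_nonneg D) auto
    also have "\<dots> = (C * D) * (s ^ (k * (n div k) + n mod k))"
      by (simp only: power_add power_mult mult_ac)
    finally show ?thesis
      by simp
  qed
  then show ?thesis
    using s unfolding growth_rates_def by auto
qed

lemma growth_rate_above:
  assumes "f \<in> carrier R" "spectral_seminorm R nrm f < t"
  shows "t \<in> growth_rates R nrm f"
proof -
  obtain s where s: "s \<in> growth_rates R nrm f" "s < t"
    by (rule growth_rate_below[OF assms])
  show ?thesis
    by (rule growth_rate_mono[OF assms(1) s(1) less_imp_le[OF s(2)]])
qed

lemma spectral_seminorm_mult:
  assumes fg: "f \<in> carrier R" "g \<in> carrier R"
  shows "spectral_seminorm R nrm (f \<otimes> g) \<le> spectral_seminorm R nrm f * spectral_seminorm R nrm g"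
proof (rule le_mult_if_le_enlarged)
  let ?\<rho> = "spectral_seminorm R nrm"
  fix e :: real assume e: "e > 0"
  obtain s where s: "s \<in> growth_rates R nrm f" "s < ?\<rho> f + e"
    by (rule growth_rate_below[OF fg(1), of "?\<rho> f + e"]) (use e in auto)
  obtain t where t: "t \<in> growth_rates R nrm g" "t < ?\<rho> g + e"
    by (rule growth_rate_below[OF fg(2), of "?\<rho> g + e"]) (use e in auto)
  have "s > 0" "t > 0"
    using s t by (auto simp: growth_rates_def)
  have "?\<rho> (f \<otimes> g) \<le> s * t"
    by (rule spectral_seminorm_le[OF growth_rate_mult[OF fg s(1) t(1)]])
  also have "\<dots> \<le> (?\<rho> f + e) * (?\<rho> g + e)"
    using s t \<open>s > 0\<close> \<open>t > 0\<close> by (intro mult_mono) auto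
  finally show "?\<rho> (f \<otimes> g) \<le> (?\<rho> f + e) * (?\<rho> g + e)" .
qed

lemma spectral_seminorm_one: "spectral_seminorm R nrm \<one> = 1"
proof (rule antisym)
  show "spectral_seminorm R nrm \<one> \<le> 1"
    using spectral_seminorm_le_nrm[of \<one>] by (simp add: nrm_one)
  show "1 \<le> spectral_seminorm R nrm \<one>"
  proof (rule ccontr)
    assume "\<not> ?thesis"
    then obtain s where s: "s \<in> growth_rates R nrm \<one>" "s < 1"
      using growth_rate_below[of \<one> 1] by auto
    obtain C where C: "C \<ge> 0" "\<And>n::nat. nrm (\<one> [^] n) \<le> C * s ^ n" "s > 0"
      by (rule growth_rateE[OF one_closed s(1)]) (rule that)
    then have "1 \<le> s"
      by (intro le_if_powers_le_const_mult[of 1 C s]) (auto simp: nrm_one)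
    with s show False by simp
  qed
qed

lemma ring_seminorm_spectral: "ring_seminorm R (spectral_seminorm R nrm)"
proof unfold_locales
  let ?\<rho> = "spectral_seminorm R nrm"
  show "0 \<le> ?\<rho> f" if "f \<in> carrier R" for f
    by (rule spectral_seminorm_nonneg[OF that])
  show "?\<rho> \<zero> = 0"
    using spectral_seminorm_le_nrm[of \<zero>] spectral_seminorm_nonneg[of \<zero>] by (simp add: nrm_zero)
  show "?\<rho> \<one> = 1"
    by (rule spectral_seminorm_one)
  show "?\<rho> (f \<otimes> g) \<le> ?\<rho> f * ?\<rho> g" if "f \<in> carrier R" "g \<in> carrier R" for f g
    by (rule spectral_seminorm_mult[OF that])
  show "?\<rho> (f \<oplus> g) \<le> max (?\<rho> f) (?\<rho> g)" if fg: "f \<in> carrier R" "g \<in> carrier R" for f g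
  proof (rule dense_ge)
    fix t assume "max (?\<rho> f) (?\<rho> g) < t"
    then have "t \<in> growth_rates R nrm f" "t \<in> growth_rates R nrm g"
      using fg by (auto intro: growth_rate_above)
    then show "?\<rho> (f \<oplus> g) \<le> t"
      by (intro spectral_seminorm_le growth_rate_add fg)
  qed
  show "?\<rho> (\<ominus> f) = ?\<rho> f" if f: "f \<in> carrier R" for f
  proof -
    have le: "?\<rho> (\<ominus> f) \<le> ?\<rho> f" if f: "f \<in> carrier R" for f
    proof -
      have "?\<rho> (\<ominus> f) = ?\<rho> (\<ominus> \<one> \<otimes> f)"
        using f by (simp add: l_minus)
      also have "\<dots> \<le> ?\<rho> (\<ominus> \<one>) * ?\<rho> f"
        using f by (intro spectral_seminorm_mult) auto
      also have "\<dots> \<le> 1 * ?\<rho> f"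
        using f spectral_seminorm_le_nrm[of "\<ominus> \<one>"]
        by (intro mult_right_mono spectral_seminorm_nonneg) (auto simp: nrm_minus nrm_one)
      finally show ?thesis by simp
    qed
    show ?thesis
      using le[OF f] le[of "\<ominus> f"] f by simp
  qed
qed

lemma power_multiplicative_spectral: "power_multiplicative R (spectral_seminorm R nrm)"
  unfolding power_multiplicative_def
proof (intro ballI allI)
  let ?\<rho> = "spectral_seminorm R nrm"
  interpret \<rho>: ring_seminorm R ?\<rho>
    by (rule ring_seminorm_spectral)
  fix f and k :: nat assume f: "f \<in> carrier R"
  show "?\<rho> (f [^] k) = ?\<rho> f ^ k"
  proof (cases "k = 0")
    case True
    then show ?thesis by (simp add: \<rho>.nrm_one)
  next
    case False
    then have k: "k > 0" by simp
    show ?thesis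
    proof (rule antisym[OF \<rho>.nrm_pow_le[OF f]], rule ccontr)
      assume "\<not> ?\<rho> f ^ k \<le> ?\<rho> (f [^] k)"
      then obtain t where t: "t \<in> growth_rates R nrm (f [^] k)" "t < ?\<rho> f ^ k"
        using growth_rate_below[OF nat_pow_closed[OF f], of k "?\<rho> f ^ k"] by auto
      then have "t > 0" by (simp add: growth_rates_def)
      then have "root k t \<in> growth_rates R nrm f"
        using t k by (intro growth_rate_root[OF f k]) auto
      then have "?\<rho> f \<le> root k t"
        by (rule spectral_seminorm_le)
      then have "?\<rho> f ^ k \<le> root k t ^ k"
        using spectral_seminorm_nonneg[OF f] by (rule power_mono)
      with t \<open>t > 0\<close> k show False by simp
    qed
  qed
qed

end

section \<open>Spectrally reduced ideals\<close>

context ring_seminorm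
begin

lemma nrm_diff_self: "f \<in> carrier R \<Longrightarrow> nrm (f \<ominus> f) = 0"
  by (metis nrm_zero r_right_minus_eq)

lemma kernel_ideal: "ideal {f \<in> carrier R. nrm f = 0} R"
proof (rule ideal_elementwiseI)
  fix x y assume xy: "x \<in> {f \<in> carrier R. nrm f = 0}" "y \<in> {f \<in> carrier R. nrm f = 0}"
  then show "x \<oplus> y \<in> {f \<in> carrier R. nrm f = 0}"
    using nrm_add[of x y] nrm_nonneg[of "x \<oplus> y"] by auto
next
  fix r x assume "r \<in> carrier R" "x \<in> {f \<in> carrier R. nrm f = 0}"
  then show "r \<otimes> x \<in> {f \<in> carrier R. nrm f = 0}"
    using nrm_mult[of r x] nrm_nonneg[of "r \<otimes> x"] by auto
qed (auto simp: nrm_zero)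

lemma nrm_one_diff_ge_1:
  assumes x: "x \<in> carrier R" "nrm x < 1"
  shows "1 \<le> nrm (\<one> \<ominus> x)"
proof -
  have "\<one> = (\<one> \<ominus> x) \<oplus> x"
    using x by algebra
  then have "1 \<le> max (nrm (\<one> \<ominus> x)) (nrm x)"
    using nrm_add[of "\<one> \<ominus> x" x] x nrm_one by simp
  with x show ?thesis by simp
qed

text \<open>Boundedness on all powers of \<open>f\<close> forces the constant down to 1, as its \<open>n\<close>-th roots tend to 1.\<close>

lemma bounded_power_multiplicative_le:
  assumes \<phi>: "bounded_seminorm R nrm \<phi>" "power_multiplicative R \<phi>" and f: "f \<in> carrier R"
  shows "\<phi> f \<le> nrm f"
proof -
  interpret \<phi>: ring_seminorm R \<phi>
    using \<phi>(1) by (simp add: bounded_seminorm_def)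
  obtain C where C: "C > 0" "\<And>g. g \<in> carrier R \<Longrightarrow> \<phi> g \<le> C * nrm g"
    using \<phi>(1) by (auto simp: bounded_seminorm_def)
  show ?thesis
  proof (rule le_if_powers_le_const_mult)
    fix n :: nat
    have "\<phi> f ^ n = \<phi> (f [^] n)"
      using \<phi>(2) f by (simp add: power_multiplicative_def)
    also have "\<dots> \<le> C * nrm (f [^] n)"
      using f by (intro C) auto
    also have "\<dots> \<le> C * nrm f ^ n"
      using C f by (intro mult_left_mono nrm_pow_le) auto
    finally show "\<phi> f ^ n \<le> C * nrm f ^ n" .
  qed (use f nrm_nonneg \<phi>.nrm_nonneg in auto)
qed

text \<open>The defining seminorm \<open>\<phi>\<close> has \<open>\<phi> (\<one> - x) \<ge> 1\<close>, because it vanishes at \<open>x\<close> and is 1 at \<open>\<one>\<close>; and it is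
  dominated by the given seminorm.\<close>

lemma spectrally_reduced_far_from_one:
  assumes J: "spectrally_reduced R nrm J" and x: "x \<in> J"
  shows "1 \<le> nrm (\<one> \<ominus> x)"
proof -
  obtain \<phi> where \<phi>: "bounded_seminorm R nrm \<phi>" "power_multiplicative R \<phi>"
    and ker: "J = {f \<in> carrier R. \<phi> f = 0}"
    using J by (auto simp: spectrally_reduced_def)
  interpret \<phi>: ring_seminorm R \<phi>
    using \<phi>(1) by (simp add: bounded_seminorm_def)
  have "1 \<le> \<phi> (\<one> \<ominus> x)"
    using x ker by (intro \<phi>.nrm_one_diff_ge_1) auto
  also have "\<dots> \<le> nrm (\<one> \<ominus> x)"
    using x ker by (intro bounded_power_multiplicative_le \<phi>) auto
  finally show ?thesis .
qed

lemma spectrally_reducedI: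
  assumes J: "ideal J R" and far: "\<And>j. j \<in> J \<Longrightarrow> 1 \<le> nrm (\<one> \<ominus> j)"
    and ker: "\<And>f. f \<in> carrier R \<Longrightarrow> spectral_seminorm R (quotient_seminorm R nrm J) f = 0 \<Longrightarrow> f \<in> J"
  shows "spectrally_reduced R nrm J"
proof -
  interpret J: ideal J R by (rule J)
  interpret q: ring_seminorm R "quotient_seminorm R nrm J"
    by (rule ring_seminorm_quotient[OF J far])
  let ?\<rho> = "spectral_seminorm R (quotient_seminorm R nrm J)"
  have le: "?\<rho> f \<le> quotient_seminorm R nrm J f" "0 \<le> ?\<rho> f" if "f \<in> carrier R" for f
    using that by (simp_all add: q.spectral_seminorm_le_nrm q.spectral_seminorm_nonneg)
  have "bounded_seminorm R nrm ?\<rho>"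
    unfolding bounded_seminorm_def
    using q.ring_seminorm_spectral le quotient_seminorm_le_nrm[OF J] by (fastforce intro: exI[of _ 1])
  moreover have "J = {f \<in> carrier R. ?\<rho> f = 0}"
  proof (intro equalityI subsetI)
    fix f assume f: "f \<in> J"
    then show "f \<in> {f \<in> carrier R. ?\<rho> f = 0}"
      using le[OF J.Icarr[OF f]] quotient_seminorm_eq_0[OF J f] J.Icarr[OF f] by simp
  qed (use ker in blast)
  moreover have "J \<noteq> carrier R"
    using far[of \<one>] nrm_diff_self[of \<one>] by auto
  ultimately show ?thesis
    unfolding spectrally_reduced_def using J q.power_multiplicative_spectral by blast
qed

text \<open>An ideal maximal among those that avoid the open unit ball around \<open>\<one>\<close> must contain the kernel of its
  spectral seminorm \<open>\<rho>\<close>: an element of the kernel within distance less than 1 of \<open>\<one>\<close> would give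
  \<open>\<rho> \<one> < 1\<close>.\<close>

lemma exists_spectrally_reduced_prime:
  assumes J: "ideal J R" and far: "\<And>j. j \<in> J \<Longrightarrow> 1 \<le> nrm (\<one> \<ominus> j)"
  obtains P where "primeideal P R" "spectrally_reduced R nrm P" "J \<subseteq> P"
proof -
  define S where "S = {u \<in> carrier R. nrm (\<one> \<ominus> u) < 1}"
  have sub: "S \<subseteq> carrier R"
    by (auto simp: S_def)
  have disj: "J \<inter> S = {}"
    using far by (force simp: S_def)
  have one: "\<one> \<in> S"
    by (simp add: S_def nrm_diff_self)
  have mult: "s \<otimes> t \<in> S" if "s \<in> S" "t \<in> S" for s t
  proof -
    have st: "s \<in> carrier R" "nrm (\<one> \<ominus> s) < 1" "t \<in> carrier R" "nrm (\<one> \<ominus> t) < 1"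
      using that by (auto simp: S_def)
    \<comment> \<open>with \<open>a = \<one> - s\<close> and \<open>b = \<one> - t\<close> this is \<open>\<one> - (\<one> - a) (\<one> - b) = a + b - a b\<close>\<close>
    have split: "\<one> \<ominus> s \<otimes> t = (\<one> \<ominus> s) \<oplus> (\<one> \<ominus> t) \<ominus> (\<one> \<ominus> s) \<otimes> (\<one> \<ominus> t)"
      using st by algebra
    have "nrm (\<one> \<ominus> s \<otimes> t) \<le> max (nrm ((\<one> \<ominus> s) \<oplus> (\<one> \<ominus> t))) (nrm ((\<one> \<ominus> s) \<otimes> (\<one> \<ominus> t)))"
      unfolding split using st by (intro nrm_diff) auto
    also have "\<dots> \<le> max (max (nrm (\<one> \<ominus> s)) (nrm (\<one> \<ominus> t))) (nrm (\<one> \<ominus> s) * nrm (\<one> \<ominus> t))"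
      using st by (intro max.mono nrm_add nrm_mult) auto
    also have "\<dots> < 1"
      using st mult_left_mono[of "nrm (\<one> \<ominus> t)" 1 "nrm (\<one> \<ominus> s)"] nrm_nonneg[of "\<one> \<ominus> s"]
      by auto
    finally show ?thesis
      using st by (simp add: S_def)
  qed
  obtain P where P: "primeideal P R" "J \<subseteq> P" "P \<inter> S = {}"
    and max: "\<And>I. ideal I R \<Longrightarrow> P \<subseteq> I \<Longrightarrow> I \<inter> S = {} \<Longrightarrow> I = P"
    by (rule prime_disjoint_from_multiplicative_set[OF J disj sub one mult]) (assumption, assumption, rule that)
  interpret P: primeideal P R by (rule P)
  have farP: "1 \<le> nrm (\<one> \<ominus> p)" if "p \<in> P" for p
    using P(3) that P.Icarr[OF that] by (force simp: S_def)
  interpret q: ring_seminorm R "quotient_seminorm R nrm P"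
    by (rule ring_seminorm_quotient[OF P.is_ideal farP])
  let ?\<rho> = "spectral_seminorm R (quotient_seminorm R nrm P)"
  interpret \<rho>: ring_seminorm R ?\<rho>
    by (rule q.ring_seminorm_spectral)
  have \<rho>_le: "?\<rho> f \<le> nrm f" if "f \<in> carrier R" for f
    using q.spectral_seminorm_le_nrm[OF that] quotient_seminorm_le_nrm[OF P.is_ideal that] by simp
  have "{f \<in> carrier R. ?\<rho> f = 0} = P"
  proof (rule max[OF \<rho>.kernel_ideal])
    show "P \<subseteq> {f \<in> carrier R. ?\<rho> f = 0}"
    proof
      fix p assume p: "p \<in> P"
      show "p \<in> {f \<in> carrier R. ?\<rho> f = 0}"
        using q.spectral_seminorm_le_nrm[OF P.Icarr[OF p]] \<rho>.nrm_nonneg[OF P.Icarr[OF p]]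
          quotient_seminorm_eq_0[OF P.is_ideal p] P.Icarr[OF p] by simp
    qed
    have "1 \<le> nrm (\<one> \<ominus> u)" if "u \<in> carrier R" "?\<rho> u = 0" for u
      using \<rho>.nrm_one_diff_ge_1[OF that(1)] that \<rho>_le[of "\<one> \<ominus> u"] by simp
    then show "{f \<in> carrier R. ?\<rho> f = 0} \<inter> S = {}"
      by (force simp: S_def)
  qed
  then have "spectrally_reduced R nrm P"
    by (intro spectrally_reducedI P.is_ideal farP) auto
  with P show ?thesis
    using that by blast
qed

text \<open>The supremum of the defining seminorms is finite because each of them is at most the given seminorm,
  with one and the same constant 1.\<close>

lemma spectrally_reduced_Inter:
  assumes sr: "\<And>P. P \<in> \<P> \<Longrightarrow> spectrally_reduced R nrm P" and ne: "\<P> \<noteq> {}"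
  shows "spectrally_reduced R nrm (\<Inter>\<P>)"
proof -
  obtain \<phi> where \<phi>: "\<And>P. P \<in> \<P> \<Longrightarrow> bounded_seminorm R nrm (\<phi> P)"
      "\<And>P. P \<in> \<P> \<Longrightarrow> power_multiplicative R (\<phi> P)"
    and ker_eq: "\<And>P. P \<in> \<P> \<Longrightarrow> P = {f \<in> carrier R. \<phi> P f = 0}"
    using sr unfolding spectrally_reduced_def by metis
  have ker: "f \<in> P \<longleftrightarrow> f \<in> carrier R \<and> \<phi> P f = 0" if "P \<in> \<P>" for P f
    by (subst ker_eq[OF that]) simp
  have sem: "ring_seminorm R (\<phi> P)" if "P \<in> \<P>" for P
    using \<phi>(1)[OF that] by (simp add: bounded_seminorm_def)
  define \<Phi> where "\<Phi> f = (SUP P\<in>\<P>. \<phi> P f)" for f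
  have le_nrm: "\<phi> P f \<le> nrm f" if "P \<in> \<P>" "f \<in> carrier R" for P f
    by (rule bounded_power_multiplicative_le[OF \<phi>[OF that(1)] that(2)])
  have upper: "\<phi> P f \<le> \<Phi> f" if "P \<in> \<P>" "f \<in> carrier R" for P f
    unfolding \<Phi>_def using that le_nrm by (intro cSUP_upper bdd_aboveI2[where M = "nrm f"]) auto
  have least: "\<Phi> f \<le> t" if "\<And>P. P \<in> \<P> \<Longrightarrow> \<phi> P f \<le> t" for f t
    unfolding \<Phi>_def using ne that by (rule cSUP_least)
  obtain P0 where P0: "P0 \<in> \<P>"
    using ne by blast
  have nonneg: "0 \<le> \<Phi> f" if "f \<in> carrier R" for f
    using upper[OF P0 that] ring_seminorm.nrm_nonneg[OF sem[OF P0] that] by simp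
  have \<Phi>: "ring_seminorm R \<Phi>"
  proof unfold_locales
    show "0 \<le> \<Phi> f" if "f \<in> carrier R" for f
      by (rule nonneg[OF that])
    show "\<Phi> \<zero> = 0" "\<Phi> \<one> = 1"
      unfolding \<Phi>_def using ne sem by (simp_all add: ring_seminorm.nrm_zero ring_seminorm.nrm_one)
    show "\<Phi> (\<ominus> f) = \<Phi> f" if "f \<in> carrier R" for f
      unfolding \<Phi>_def using sem that by (simp add: ring_seminorm.nrm_minus)
    show "\<Phi> (f \<oplus> g) \<le> max (\<Phi> f) (\<Phi> g)" if "f \<in> carrier R" "g \<in> carrier R" for f g
    proof (rule least)
      fix P assume P: "P \<in> \<P>"
      show "\<phi> P (f \<oplus> g) \<le> max (\<Phi> f) (\<Phi> g)"
        using ring_seminorm.nrm_add[OF sem[OF P] that] upper[OF P that(1)] upper[OF P that(2)] by linarith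
    qed
    show "\<Phi> (f \<otimes> g) \<le> \<Phi> f * \<Phi> g" if "f \<in> carrier R" "g \<in> carrier R" for f g
    proof (rule least)
      fix P assume P: "P \<in> \<P>"
      have "\<phi> P (f \<otimes> g) \<le> \<phi> P f * \<phi> P g"
        by (rule ring_seminorm.nrm_mult[OF sem[OF P] that])
      also have "\<dots> \<le> \<Phi> f * \<Phi> g"
        using P that by (intro mult_mono upper nonneg ring_seminorm.nrm_nonneg[OF sem]) auto
      finally show "\<phi> P (f \<otimes> g) \<le> \<Phi> f * \<Phi> g" .
    qed
  qed
  interpret \<Phi>: ring_seminorm R \<Phi> by (rule \<Phi>)
  have "power_multiplicative R \<Phi>"
    unfolding power_multiplicative_def
  proof (intro ballI allI)
    fix f and n :: nat assume f: "f \<in> carrier R"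
    show "\<Phi> (f [^] n) = \<Phi> f ^ n"
    proof (cases "n = 0")
      case False
      have "\<phi> P f \<le> root n (\<Phi> (f [^] n))" if P: "P \<in> \<P>" for P
      proof (rule power_le_imp_le_base)
        show "\<phi> P f ^ Suc (n - 1) \<le> root n (\<Phi> (f [^] n)) ^ Suc (n - 1)"
          using False upper[OF P, of "f [^] n"] nonneg[of "f [^] n"] \<phi>(2)[OF P] f
          by (simp add: power_multiplicative_def)
      qed (use f False nonneg in auto)
      then have "\<Phi> f ^ n \<le> root n (\<Phi> (f [^] n)) ^ n"
        using f by (intro power_mono least nonneg)
      with \<Phi>.nrm_pow_le[OF f, of n] False nonneg[of "f [^] n"] f show ?thesis
        by simp
    qed (simp add: \<Phi>.nrm_one)
  qed
  moreover have "bounded_seminorm R nrm \<Phi>"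
    unfolding bounded_seminorm_def using \<Phi> le_nrm by (auto intro!: exI[of _ 1] least)
  moreover have "\<Inter>\<P> = {f \<in> carrier R. \<Phi> f = 0}"
  proof (intro equalityI subsetI)
    fix f assume f: "f \<in> \<Inter>\<P>"
    then have carr: "f \<in> carrier R"
      using ker[OF P0] P0 by blast
    have "\<Phi> f \<le> 0"
      by (rule least) (use f ker in force)
    with carr nonneg[OF carr] show "f \<in> {f \<in> carrier R. \<Phi> f = 0}"
      by simp
  next
    fix f assume f: "f \<in> {f \<in> carrier R. \<Phi> f = 0}"
    have "f \<in> P" if P: "P \<in> \<P>" for P
      using upper[OF P, of f] ring_seminorm.nrm_nonneg[OF sem[OF P], of f] f ker[OF P] by auto
    then show "f \<in> \<Inter>\<P>" by blast
  qed
  moreover have "\<Phi> \<one> \<noteq> 0"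
    by (simp add: \<Phi>.nrm_one)
  ultimately show ?thesis
    unfolding spectrally_reduced_def using \<Phi>.kernel_ideal by auto
qed

end

section \<open>Quasi-compactness and sobriety of the topological spectrum\<close>

context ring_seminorm
begin

lemma topspace_Spec_Top: "topspace (Spec_Top R nrm) = {p. primeideal p R \<and> spectrally_reduced R nrm p}"
  unfolding Spec_Top_def by (auto simp: topspace_zariski Spec_def)

lemma closedin_Spec_Top:
  "closedin (Spec_Top R nrm) Z \<longleftrightarrow>
     (\<exists>E\<subseteq>carrier R. Z = {p. primeideal p R \<and> spectrally_reduced R nrm p \<and> E \<subseteq> p})"
proof -
  let ?X = "{p. primeideal p R \<and> spectrally_reduced R nrm p}"
  have "closedin (Spec_Top R nrm) Z \<longleftrightarrow>
      (\<exists>E\<subseteq>carrier R. Z \<subseteq> ?X \<and>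
        ?X - Z = (Spec R - zariski_closed R E) \<inter> {p \<in> Spec R. spectrally_reduced R nrm p})"
    unfolding closedin_def topspace_Spec_Top unfolding Spec_Top_def openin_subtopology openin_zariski by blast
  moreover have "Z \<subseteq> ?X \<and> ?X - Z = (Spec R - zariski_closed R E) \<inter> {p \<in> Spec R. spectrally_reduced R nrm p}
      \<longleftrightarrow> Z = {p. primeideal p R \<and> spectrally_reduced R nrm p \<and> E \<subseteq> p}" for E
    unfolding zariski_closed_def Spec_def by blast
  ultimately show ?thesis by simp
qed

text \<open>The elements that vanish at every point of some finite intersection of members of the family form an
  ideal.  Finite intersections are nonempty, so each such element lies in a spectrally reduced ideal
  and is far from \<open>\<one>\<close>.  A spectrally reduced prime above this ideal lies in every member.\<close>

lemma compact_space_Spec_Top: "compact_space (Spec_Top R nrm)"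
  unfolding compact_space_fip
proof (intro allI impI, elim conjE)
  fix \<U>
  assume closed: "\<forall>C\<in>\<U>. closedin (Spec_Top R nrm) C"
    and fip: "\<forall>\<F>. finite \<F> \<and> \<F> \<subseteq> \<U> \<longrightarrow> \<Inter>\<F> \<noteq> {}"
  show "\<Inter>\<U> \<noteq> {}"
  proof (cases "\<U> = {}")
    case False
    then obtain C0 where C0: "C0 \<in> \<U>" by blast
    have points: "primeideal p R" "spectrally_reduced R nrm p" if "p \<in> C" "C \<in> \<U>" for p C
      using closed that by (force simp: closedin_Spec_Top)+
    \<comment> \<open>demanding \<open>C0 \<in> \<F>\<close> keeps \<open>\<F>\<close> nonempty, so that the points of \<open>\<Inter>\<F>\<close> are prime ideals\<close>
    define J where "J = {x \<in> carrier R. \<exists>\<F>. finite \<F> \<and> \<F> \<subseteq> \<U> \<and> C0 \<in> \<F> \<and> (\<forall>p\<in>\<Inter>\<F>. x \<in> p)}"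
    have pt_ideal: "ideal p R" if "p \<in> \<Inter>\<F>" "\<F> \<subseteq> \<U>" "C0 \<in> \<F>" for p \<F>
      using points(1)[of p C0] that primeideal.axioms(1) by blast
    have "ideal J R"
    proof (rule ideal_elementwiseI)
      show "J \<subseteq> carrier R" by (auto simp: J_def)
      show "\<zero> \<in> J"
        unfolding J_def using C0 pt_ideal[of _ "{C0}"]
        by (auto intro!: exI[of _ "{C0}"] additive_subgroup.zero_closed ideal.axioms(1))
    next
      fix x y assume "x \<in> J" "y \<in> J"
      then obtain \<F> \<G> where F: "finite \<F>" "\<F> \<subseteq> \<U>" "C0 \<in> \<F>" "\<forall>p\<in>\<Inter>\<F>. x \<in> p"
        and G: "finite \<G>" "\<G> \<subseteq> \<U>" "C0 \<in> \<G>" "\<forall>p\<in>\<Inter>\<G>. y \<in> p"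
        and xy: "x \<in> carrier R" "y \<in> carrier R"
        by (auto simp: J_def)
      have "x \<oplus> y \<in> p" if p: "p \<in> \<Inter>(\<F> \<union> \<G>)" for p
      proof -
        have "ideal p R" using pt_ideal[of p "\<F> \<union> \<G>"] p F G by blast
        then show ?thesis
          using p F(4) G(4) by (intro additive_subgroup.a_closed ideal.axioms(1)) auto
      qed
      then show "x \<oplus> y \<in> J"
        unfolding J_def using F G xy by (auto intro!: exI[of _ "\<F> \<union> \<G>"])
    next
      fix r x assume r: "r \<in> carrier R" and "x \<in> J"
      then obtain \<F> where F: "finite \<F>" "\<F> \<subseteq> \<U>" "C0 \<in> \<F>" "\<forall>p\<in>\<Inter>\<F>. x \<in> p" "x \<in> carrier R"
        by (auto simp: J_def)
      then have "\<forall>p\<in>\<Inter>\<F>. r \<otimes> x \<in> p"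
        using pt_ideal r by (meson ideal.I_l_closed)
      then show "r \<otimes> x \<in> J"
        unfolding J_def using F r by blast
    qed
    moreover have "1 \<le> nrm (\<one> \<ominus> x)" if x: "x \<in> J" for x
    proof -
      obtain \<F> where F: "finite \<F>" "\<F> \<subseteq> \<U>" "C0 \<in> \<F>" "\<forall>p\<in>\<Inter>\<F>. x \<in> p"
        using x by (auto simp: J_def)
      have "\<Inter>\<F> \<noteq> {}"
        by (rule fip[rule_format, OF conjI[OF F(1,2)]])
      then obtain p where p: "p \<in> \<Inter>\<F>"
        by (meson equals0I)
      have "spectrally_reduced R nrm p"
        using points(2)[OF InterD[OF p F(3)] C0] .
      then show ?thesis
        using F(4) p by (intro spectrally_reduced_far_from_one[of p]) auto
    qed
    ultimately obtain P where P: "primeideal P R" "spectrally_reduced R nrm P" "J \<subseteq> P"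
      using exists_spectrally_reduced_prime by blast
    have "P \<in> C" if C: "C \<in> \<U>" for C
    proof -
      obtain E where E: "E \<subseteq> carrier R" "C = {p. primeideal p R \<and> spectrally_reduced R nrm p \<and> E \<subseteq> p}"
        using closed C by (auto simp: closedin_Spec_Top)
      have "E \<subseteq> J"
        unfolding J_def using E C C0 by (auto intro!: exI[of _ "{C0, C}"])
      with P E show ?thesis by blast
    qed
    then show ?thesis by blast
  qed simp
qed

lemma closure_of_point_Spec_Top:
  assumes x: "primeideal x R" "spectrally_reduced R nrm x"
  shows "Spec_Top R nrm closure_of {x} = {p. primeideal p R \<and> spectrally_reduced R nrm p \<and> x \<subseteq> p}"
proof
  show "Spec_Top R nrm closure_of {x} \<subseteq> {p. primeideal p R \<and> spectrally_reduced R nrm p \<and> x \<subseteq> p}"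
  proof (rule closure_of_minimal)
    have "x \<subseteq> carrier R"
      using x(1) by (simp add: additive_subgroup.a_subset ideal.axioms(1) primeideal.axioms(1))
    then show "closedin (Spec_Top R nrm) {p. primeideal p R \<and> spectrally_reduced R nrm p \<and> x \<subseteq> p}"
      unfolding closedin_Spec_Top by blast
  qed (use x in auto)
  have "closedin (Spec_Top R nrm) (Spec_Top R nrm closure_of {x})"
    by simp
  then obtain E where E: "Spec_Top R nrm closure_of {x} = {p. primeideal p R \<and> spectrally_reduced R nrm p \<and> E \<subseteq> p}"
    unfolding closedin_Spec_Top by blast
  have "x \<in> Spec_Top R nrm closure_of {x}"
    using closure_of_subset[of "{x}" "Spec_Top R nrm"] x by (simp add: topspace_Spec_Top)
  then show "{p. primeideal p R \<and> spectrally_reduced R nrm p \<and> x \<subseteq> p} \<subseteq> Spec_Top R nrm closure_of {x}"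
    unfolding E by blast
qed

lemma sober_space_Spec_Top: "sober_space (Spec_Top R nrm)"
  unfolding sober_space_def
proof (intro allI impI, elim conjE)
  let ?X = "Spec_Top R nrm"
  fix Z assume closed: "closedin ?X Z" and irred: "irreducible_in ?X Z"
  obtain E where E: "E \<subseteq> carrier R" "Z = {p. primeideal p R \<and> spectrally_reduced R nrm p \<and> E \<subseteq> p}"
    using closed by (auto simp: closedin_Spec_Top)
  have ne: "Z \<noteq> {}"
    using irred by (simp add: irreducible_in_def)
  have sr: "spectrally_reduced R nrm (\<Inter>Z)"
    using ne E by (intro spectrally_reduced_Inter) auto
  have prime: "primeideal (\<Inter>Z) R"
  proof (rule primeidealI)
    show "ideal (\<Inter>Z) R" "carrier R \<noteq> \<Inter>Z"
      using sr by (auto simp: spectrally_reduced_def)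
    show "cring R" by (rule is_cring)
  next
    fix a b assume ab: "a \<in> carrier R" "b \<in> carrier R" "a \<otimes> b \<in> \<Inter>Z"
    let ?V = "\<lambda>c. {p. primeideal p R \<and> spectrally_reduced R nrm p \<and> {c} \<subseteq> p}"
    have "closedin ?X (?V a)" "closedin ?X (?V b)"
      unfolding closedin_Spec_Top using ab by blast+
    moreover have "Z \<subseteq> ?V a \<union> ?V b"
    proof
      fix p assume p: "p \<in> Z"
      then have "primeideal p R" "spectrally_reduced R nrm p"
        using E(2) by auto
      then show "p \<in> ?V a \<union> ?V b"
        using primeideal.I_prime[of p R a b] ab p by auto
    qed
    ultimately have "Z \<subseteq> ?V a \<or> Z \<subseteq> ?V b"
      using irred by (simp add: irreducible_in_def)
    then show "a \<in> \<Inter>Z \<or> b \<in> \<Inter>Z"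
      by blast
  qed
  have generic: "?X closure_of {\<Inter>Z} = Z"
    unfolding closure_of_point_Spec_Top[OF prime sr] using E by blast
  show "\<exists>!x. x \<in> topspace ?X \<and> ?X closure_of {x} = Z"
  proof (rule ex1I)
    show "\<Inter>Z \<in> topspace ?X \<and> ?X closure_of {\<Inter>Z} = Z"
      using generic prime sr by (simp add: topspace_Spec_Top)
    fix x assume "x \<in> topspace ?X \<and> ?X closure_of {x} = Z"
    then have x: "primeideal x R" "spectrally_reduced R nrm x" "?X closure_of {x} = Z"
      by (auto simp: topspace_Spec_Top)
    have Z: "Z = {p. primeideal p R \<and> spectrally_reduced R nrm p \<and> x \<subseteq> p}"
      by (rule closure_of_point_Spec_Top[OF x(1,2), unfolded x(3)])
    then show "x = \<Inter>Z"
      using x by blast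
  qed
qed

end

section \<open>Linear combinations and closures of ideals\<close>

definition lincomb :: "('a, 'm) ring_scheme \<Rightarrow> 'i set \<Rightarrow> ('i \<Rightarrow> 'a) \<Rightarrow> ('i \<Rightarrow> 'a) \<Rightarrow> 'a" where
  "lincomb R F w b = (\<Oplus>\<^bsub>R\<^esub>i\<in>F. b i \<otimes>\<^bsub>R\<^esub> w i)"

context cring
begin

lemma lincomb_closed: "b \<in> F \<rightarrow> carrier R \<Longrightarrow> w \<in> F \<rightarrow> carrier R \<Longrightarrow> lincomb R F w b \<in> carrier R"
  unfolding lincomb_def by (intro finsum_closed) auto

lemma lincomb_zero:
  assumes "w \<in> F \<rightarrow> carrier R"
  shows "lincomb R F w (\<lambda>i. \<zero>) = \<zero>"
proof -
  have "lincomb R F w (\<lambda>i. \<zero>) = (\<Oplus>i\<in>F. \<zero>)"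
    unfolding lincomb_def using assms by (intro finsum_cong' refl) (auto simp: Pi_iff)
  then show ?thesis by simp
qed

lemma lincomb_add:
  assumes "b \<in> F \<rightarrow> carrier R" "c \<in> F \<rightarrow> carrier R" "w \<in> F \<rightarrow> carrier R"
  shows "lincomb R F w (\<lambda>i. b i \<oplus> c i) = lincomb R F w b \<oplus> lincomb R F w c"
proof -
  have "lincomb R F w (\<lambda>i. b i \<oplus> c i) = (\<Oplus>i\<in>F. b i \<otimes> w i \<oplus> c i \<otimes> w i)"
    unfolding lincomb_def using assms
    by (intro finsum_cong' refl) (auto simp: Pi_iff l_distr)
  also have "\<dots> = lincomb R F w b \<oplus> lincomb R F w c"
    unfolding lincomb_def using assms by (intro finsum_addf) (auto simp: Pi_iff)
  finally show ?thesis .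
qed

lemma lincomb_scale:
  assumes "finite F" "r \<in> carrier R" "b \<in> F \<rightarrow> carrier R" "w \<in> F \<rightarrow> carrier R"
  shows "lincomb R F w (\<lambda>i. r \<otimes> b i) = r \<otimes> lincomb R F w b"
proof -
  have "lincomb R F w (\<lambda>i. r \<otimes> b i) = (\<Oplus>i\<in>F. r \<otimes> (b i \<otimes> w i))"
    unfolding lincomb_def using assms
    by (intro finsum_cong' refl) (auto simp: Pi_iff m_assoc)
  also have "\<dots> = r \<otimes> lincomb R F w b"
    unfolding lincomb_def using assms by (intro finsum_rdistr[symmetric]) (auto simp: Pi_iff)
  finally show ?thesis .
qed

lemma lincomb_diff:
  assumes "finite F" "b \<in> F \<rightarrow> carrier R" "c \<in> F \<rightarrow> carrier R" "w \<in> F \<rightarrow> carrier R"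
  shows "lincomb R F w (\<lambda>i. b i \<ominus> c i) = lincomb R F w b \<ominus> lincomb R F w c"
proof -
  have "lincomb R F w (\<lambda>i. b i \<ominus> c i) = lincomb R F w (\<lambda>i. b i \<oplus> (\<ominus> \<one>) \<otimes> c i)"
    unfolding lincomb_def using assms
    by (intro finsum_cong' refl) (auto simp: Pi_iff minus_eq l_minus)
  also have "\<dots> = lincomb R F w b \<oplus> (\<ominus> \<one>) \<otimes> lincomb R F w c"
    using assms by (subst lincomb_add) (auto simp: Pi_iff lincomb_scale)
  also have "\<dots> = lincomb R F w b \<ominus> lincomb R F w c"
    using lincomb_closed[of c F w] assms by (simp add: minus_eq l_minus)
  finally show ?thesis .
qed

lemma lincomb_diff_family:
  assumes "finite F" "b \<in> F \<rightarrow> carrier R" "v \<in> F \<rightarrow> carrier R" "w \<in> F \<rightarrow> carrier R"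
  shows "lincomb R F v b \<ominus> lincomb R F w b = lincomb R F (\<lambda>i. v i \<ominus> w i) b"
proof -
  have swap: "lincomb R F x y = lincomb R F y x" if "x \<in> F \<rightarrow> carrier R" "y \<in> F \<rightarrow> carrier R" for x y
    unfolding lincomb_def using that by (intro finsum_cong' refl) (auto simp: Pi_iff m_comm)
  have "(\<lambda>i. v i \<ominus> w i) \<in> F \<rightarrow> carrier R"
    using assms by (auto simp: Pi_iff)
  then show ?thesis
    using assms by (simp add: swap[of _ b] lincomb_diff)
qed

lemma lincomb_insert:
  assumes "finite F" "i \<notin> F" "b \<in> insert i F \<rightarrow> carrier R" "w \<in> insert i F \<rightarrow> carrier R"
  shows "lincomb R (insert i F) w b = b i \<otimes> w i \<oplus> lincomb R F w b"
  unfolding lincomb_def using assms by (intro finsum_insert) (auto simp: Pi_iff)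

lemma lincomb_in_ideal:
  assumes I: "ideal I R" and F: "finite F" "b \<in> F \<rightarrow> carrier R" "w \<in> F \<rightarrow> I"
  shows "lincomb R F w b \<in> I"
proof -
  interpret I: ideal I R by (rule I)
  show ?thesis
    using F
  proof (induction F)
    case (insert i F)
    have "lincomb R (insert i F) w b = b i \<otimes> w i \<oplus> lincomb R F w b"
      unfolding lincomb_def using insert.hyps insert.prems I.Icarr
      by (intro finsum_insert) (auto simp: Pi_iff)
    with insert show ?case
      by (auto simp: Pi_iff intro!: I.a_closed I.I_l_closed)
  qed (simp add: lincomb_def)
qed

lemma lincomb_delta:
  assumes "finite F" "i \<in> F" "w \<in> F \<rightarrow> carrier R"
  shows "lincomb R F w (\<lambda>j. if j = i then \<one> else \<zero>) = w i"
proof -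
  have "lincomb R F w (\<lambda>j. if j = i then \<one> else \<zero>) = (\<Oplus>j\<in>F. if i = j then w j else \<zero>)"
    unfolding lincomb_def using assms by (intro finsum_cong' refl) (auto simp: Pi_iff)
  also have "\<dots> = w i"
    using assms by (intro finsum_singleton) auto
  finally show ?thesis .
qed

lemma genideal_eq_lincombs:
  assumes F: "finite F" "F \<subseteq> carrier R" and x: "x \<in> Idl F"
  obtains b where "b \<in> F \<rightarrow> carrier R" "x = lincomb R F (\<lambda>g. g) b"
proof -
  let ?I = "{lincomb R F (\<lambda>g. g) b | b. b \<in> F \<rightarrow> carrier R}"
  have w: "(\<lambda>g. g) \<in> F \<rightarrow> carrier R"
    using F by auto
  have "ideal ?I R"
  proof (rule ideal_elementwiseI)
    show "?I \<subseteq> carrier R"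
      using lincomb_closed[OF _ w] by auto
    show "\<zero> \<in> ?I"
      using lincomb_zero[OF w] by (auto intro!: exI[of _ "\<lambda>g. \<zero>"])
  next
    fix x y assume "x \<in> ?I" "y \<in> ?I"
    then obtain b c where "b \<in> F \<rightarrow> carrier R" "x = lincomb R F (\<lambda>g. g) b"
      "c \<in> F \<rightarrow> carrier R" "y = lincomb R F (\<lambda>g. g) c"
      by blast
    then show "x \<oplus> y \<in> ?I"
      using lincomb_add[of b F c, OF _ _ w] by (auto intro!: exI[of _ "\<lambda>g. b g \<oplus> c g"] simp: Pi_iff)
  next
    fix r x assume r: "r \<in> carrier R" and "x \<in> ?I"
    then obtain b where "b \<in> F \<rightarrow> carrier R" "x = lincomb R F (\<lambda>g. g) b"
      by blast
    then show "r \<otimes> x \<in> ?I"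
      using lincomb_scale[OF F(1) r, of b, OF _ w] r by (auto intro!: exI[of _ "\<lambda>g. r \<otimes> b g"] simp: Pi_iff)
  qed
  moreover have "F \<subseteq> ?I"
  proof
    fix g assume "g \<in> F"
    then show "g \<in> ?I"
      using lincomb_delta[OF F(1) _ w, of g] by (auto intro!: exI[of _ "\<lambda>j. if j = g then \<one> else \<zero>"])
  qed
  ultimately have "Idl F \<subseteq> ?I"
    by (rule genideal_minimal)
  with x that show ?thesis by blast
qed

end

definition norm_closure :: "('a, 'm) ring_scheme \<Rightarrow> ('a \<Rightarrow> real) \<Rightarrow> 'a set \<Rightarrow> 'a set" where
  "norm_closure R nrm I = {x \<in> carrier R. \<forall>e>0. \<exists>y\<in>I. nrm (x \<ominus>\<^bsub>R\<^esub> y) < e}"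

context ring_seminorm
begin

lemma nrm_minus_commute: "x \<in> carrier R \<Longrightarrow> y \<in> carrier R \<Longrightarrow> nrm (x \<ominus> y) = nrm (y \<ominus> x)"
  using nrm_minus[of "x \<ominus> y"] by (simp add: minus_eq minus_add a_comm)

lemma nrm_diff_triangle:
  assumes "x \<in> carrier R" "y \<in> carrier R" "z \<in> carrier R"
  shows "nrm (x \<ominus> z) \<le> max (nrm (x \<ominus> y)) (nrm (y \<ominus> z))"
proof -
  have "x \<ominus> z = (x \<ominus> y) \<oplus> (y \<ominus> z)"
    using assms by algebra
  then show ?thesis
    using nrm_add[of "x \<ominus> y" "y \<ominus> z"] assms by simp
qed

lemma nrm_lincomb_le:
  assumes F: "finite F" "b \<in> F \<rightarrow> carrier R" "w \<in> F \<rightarrow> carrier R"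
    and B: "\<And>i. i \<in> F \<Longrightarrow> nrm (b i) * nrm (w i) \<le> B" "0 \<le> B"
  shows "nrm (lincomb R F w b) \<le> B"
  using F B(1)
proof (induction F)
  case (insert i F)
  have carr: "b i \<in> carrier R" "w i \<in> carrier R" "lincomb R F w b \<in> carrier R"
    using insert.prems by (auto intro!: lincomb_closed)
  have "nrm (b i \<otimes> w i \<oplus> lincomb R F w b) \<le> max (nrm (b i \<otimes> w i)) (nrm (lincomb R F w b))"
    using carr by (intro nrm_add) auto
  also have "\<dots> \<le> B"
    using insert nrm_mult[OF carr(1,2)] by (auto intro: order_trans)
  finally show ?case
    using insert by (simp add: lincomb_insert)
qed (use B(2) in \<open>simp add: lincomb_def nrm_zero\<close>)

lemma subset_norm_closure:
  assumes "I \<subseteq> carrier R"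
  shows "I \<subseteq> norm_closure R nrm I"
proof
  fix x assume "x \<in> I"
  moreover from this have "x \<in> carrier R" "nrm (x \<ominus> x) = 0"
    using assms nrm_diff_self by auto
  ultimately show "x \<in> norm_closure R nrm I"
    unfolding norm_closure_def by (auto intro!: bexI[of _ x])
qed

lemma norm_closure_idem:
  assumes "I \<subseteq> carrier R"
  shows "norm_closure R nrm (norm_closure R nrm I) \<subseteq> norm_closure R nrm I"
proof
  fix x assume x: "x \<in> norm_closure R nrm (norm_closure R nrm I)"
  have "\<exists>z\<in>I. nrm (x \<ominus> z) < e" if e: "e > 0" for e
  proof -
    obtain y where y: "y \<in> norm_closure R nrm I" "nrm (x \<ominus> y) < e"
      using x e by (auto simp: norm_closure_def)
    then obtain z where z: "z \<in> I" "nrm (y \<ominus> z) < e"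
      using e by (auto simp: norm_closure_def)
    show ?thesis
      using nrm_diff_triangle[of x y z] x y z assms
      by (intro bexI[of _ z]) (auto simp: norm_closure_def)
  qed
  then show "x \<in> norm_closure R nrm I"
    using x by (auto simp: norm_closure_def)
qed

lemma ideal_norm_closure:
  assumes I: "ideal I R"
  shows "ideal (norm_closure R nrm I) R"
proof (rule ideal_elementwiseI)
  interpret I: ideal I R by (rule I)
  show "norm_closure R nrm I \<subseteq> carrier R"
    by (auto simp: norm_closure_def)
  show "\<zero> \<in> norm_closure R nrm I"
    using subset_norm_closure[OF I.a_subset] I.zero_closed by blast
  {
    fix x y assume xy: "x \<in> norm_closure R nrm I" "y \<in> norm_closure R nrm I"
    then have carr: "x \<in> carrier R" "y \<in> carrier R"
      by (auto simp: norm_closure_def)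
    have "\<exists>z\<in>I. nrm (x \<oplus> y \<ominus> z) < e" if e: "e > 0" for e
    proof -
      obtain z where z: "z \<in> I" "nrm (x \<ominus> z) < e"
        using xy e by (auto simp: norm_closure_def)
      obtain z' where z': "z' \<in> I" "nrm (y \<ominus> z') < e"
        using xy e by (auto simp: norm_closure_def)
      have zc: "z \<in> carrier R" "z' \<in> carrier R"
        using z z' I.Icarr by auto
      have "x \<oplus> y \<ominus> (z \<oplus> z') = (x \<ominus> z) \<oplus> (y \<ominus> z')"
        using carr zc by algebra
      then have "nrm (x \<oplus> y \<ominus> (z \<oplus> z')) < e"
        using nrm_add[of "x \<ominus> z" "y \<ominus> z'"] carr zc z z' by simp
      then show ?thesis
        using z z' by (intro bexI[of _ "z \<oplus> z'"]) auto
    qed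
    then show "x \<oplus> y \<in> norm_closure R nrm I"
      using carr by (auto simp: norm_closure_def)
  next
    fix r x assume r: "r \<in> carrier R" and x: "x \<in> norm_closure R nrm I"
    then have carr: "x \<in> carrier R"
      by (auto simp: norm_closure_def)
    have "\<exists>z\<in>I. nrm (r \<otimes> x \<ominus> z) < e" if e: "e > 0" for e
    proof -
      have pos: "nrm r + 1 > 0"
        using nrm_nonneg[OF r] by simp
      obtain z where z: "z \<in> I" "nrm (x \<ominus> z) < e / (nrm r + 1)"
        using x divide_pos_pos[OF e pos] by (auto simp: norm_closure_def)
      have zc: "z \<in> carrier R"
        using z I.Icarr by auto
      have "r \<otimes> x \<ominus> r \<otimes> z = r \<otimes> (x \<ominus> z)"
        using r carr zc by algebra
      then have "nrm (r \<otimes> x \<ominus> r \<otimes> z) \<le> nrm r * nrm (x \<ominus> z)"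
        using nrm_mult[of r "x \<ominus> z"] r carr zc by simp
      also have "\<dots> \<le> (nrm r + 1) * nrm (x \<ominus> z)"
        using carr zc by (intro mult_right_mono nrm_nonneg) auto
      also have "\<dots> < e"
        using z pos by (simp add: field_simps)
      finally show ?thesis
        using z r by (intro bexI[of _ "r \<otimes> z"]) (auto intro: I.I_l_closed)
    qed
    then show "r \<otimes> x \<in> norm_closure R nrm I"
      using r carr by (auto simp: norm_closure_def)
  }
qed

text \<open>If \<open>\<bar>\<one> - x\<bar> < 1\<close>, the elements \<open>\<one> - (\<one> - x) ^ n\<close> of the ideal converge to \<open>\<one>\<close>.\<close>

lemma closed_proper_ideal_far_from_one:
  assumes I: "ideal I R" and closed: "norm_closure R nrm I \<subseteq> I" and proper: "\<one> \<notin> I" and x: "x \<in> I"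
  shows "1 \<le> nrm (\<one> \<ominus> x)"
proof (rule ccontr)
  assume "\<not> ?thesis"
  then have small: "nrm (\<one> \<ominus> x) < 1" by simp
  interpret I: ideal I R by (rule I)
  have carr: "x \<in> carrier R"
    using I.Icarr[OF x] .
  have mem: "\<one> \<ominus> (\<one> \<ominus> x) [^] n \<in> I" for n :: nat
  proof (induction n)
    case 0
    then show ?case by (simp add: minus_eq r_neg)
  next
    case (Suc n)
    have c: "(\<one> \<ominus> x) [^] n \<in> carrier R"
      using carr by auto
    have "\<one> \<ominus> (\<one> \<ominus> x) [^] Suc n = (\<one> \<ominus> (\<one> \<ominus> x) [^] n) \<oplus> (\<one> \<ominus> x) [^] n \<otimes> x"
      using carr c unfolding nat_pow_Suc by algebra
    also have "\<dots> \<in> I"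
      using Suc.IH x c by (intro I.a_closed I.I_l_closed)
    finally show ?case .
  qed
  have "\<exists>y\<in>I. nrm (\<one> \<ominus> y) < e" if e: "e > 0" for e
  proof -
    obtain n where n: "nrm (\<one> \<ominus> x) ^ n < e"
      using real_arch_pow_inv[OF e small] by blast
    have c: "(\<one> \<ominus> x) [^] n \<in> carrier R"
      using carr by auto
    have "\<one> \<ominus> (\<one> \<ominus> (\<one> \<ominus> x) [^] n) = (\<one> \<ominus> x) [^] n"
      using c by algebra
    then have "nrm (\<one> \<ominus> (\<one> \<ominus> (\<one> \<ominus> x) [^] n)) < e"
      using nrm_pow_le[of "\<one> \<ominus> x" n] n carr by simp
    with mem show ?thesis by blast
  qed
  then have "\<one> \<in> norm_closure R nrm I"
    by (auto simp: norm_closure_def)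
  with closed proper show False by blast
qed

end

section \<open>Successive approximation and open mappings\<close>

text \<open>Besides completeness, the Baire argument needs to rescale elements to a given size, up to a bounded factor.  A unit of
  norm less than 1 that multiplies norms, a uniformizer \<open>\<pi>\<close>, provides this; in a Banach algebra the
  scalars of absolute value strictly between 0 and 1 are such units.\<close>

locale complete_tate_ring = ring_norm +
  fixes \<pi>
  assumes complete: "norm_complete R nrm"
    and pi_unit: "\<pi> \<in> Units R"
    and pi_small: "nrm \<pi> < 1"
    and nrm_pi_mult: "x \<in> carrier R \<Longrightarrow> nrm (\<pi> \<otimes> x) = nrm \<pi> * nrm x"
begin

lemma Cauchy_converges:
  assumes s: "\<And>n::nat. s n \<in> carrier R"
    and Cauchy: "\<And>e. e > 0 \<Longrightarrow> \<exists>N. \<forall>n\<ge>N. \<forall>m\<ge>N. nrm (s n \<ominus> s m) < e"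
  obtains l where "l \<in> carrier R" "\<And>e. e > 0 \<Longrightarrow> \<exists>N. \<forall>n\<ge>N. nrm (s n \<ominus> l) < e"
proof -
  interpret M: Metric_space "carrier R" "norm_dist R nrm"
    by (rule Metric_space_norm_dist)
  have "M.MCauchy s"
    unfolding M.MCauchy_def using s Cauchy by (fastforce simp: norm_dist_def)
  then obtain l where l: "limitin M.mtopology s l sequentially"
    using complete unfolding norm_complete_def M.mcomplete_def by blast
  then have "l \<in> carrier R" "\<And>e. e > 0 \<Longrightarrow> \<exists>N. \<forall>n\<ge>N. nrm (s n \<ominus> l) < e"
    using s unfolding M.limit_metric_sequentially by (auto simp: norm_dist_def)
  then show ?thesis
    using that by blast
qed

lemma geometric_series_converges:
  assumes b: "\<And>k::nat. b k \<in> carrier R" and D: "\<And>k. nrm (b k) \<le> D * (1/2) ^ k" "0 \<le> D"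
  obtains l where "l \<in> carrier R" "\<And>n. nrm (l \<ominus> (\<Oplus>k\<in>{..<n}. b k)) \<le> D * (1/2) ^ n"
proof -
  let ?S = "\<lambda>n. \<Oplus>k\<in>{..<n}. b k"
  have S: "?S n \<in> carrier R" for n
    using b by (intro finsum_closed) auto
  have S_Suc: "?S (Suc n) = ?S n \<oplus> b n" for n
    using b by (simp add: lessThan_Suc finsum_insert a_comm S)
  have tail: "nrm (?S (n + m) \<ominus> ?S n) \<le> D * (1/2) ^ n" for n m
  proof (induction m)
    case 0
    then show ?case using D S by (simp add: nrm_diff_self)
  next
    case (Suc m)
    have "?S (n + Suc m) \<ominus> ?S (n + m) = b (n + m)"
      unfolding add_Suc_right S_Suc using S[of "n + m"] b[of "n + m"] by algebra
    then have "nrm (?S (n + Suc m) \<ominus> ?S n) \<le> max (nrm (b (n + m))) (nrm (?S (n + m) \<ominus> ?S n))"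
      using nrm_diff_triangle[OF S[of "n + Suc m"] S[of "n + m"] S[of n]] by simp
    moreover have "nrm (b (n + m)) \<le> D * (1/2) ^ n"
      using D(1)[of "n + m"] mult_left_mono[OF power_decreasing[of n "n + m" "1/2 :: real"] D(2)] by simp
    ultimately show ?case
      using Suc.IH by simp
  qed
  have "\<exists>N. \<forall>n\<ge>N. \<forall>m\<ge>N. nrm (?S n \<ominus> ?S m) < e" if e: "e > 0" for e
  proof -
    obtain N where N: "(1/2) ^ N < e / (D + 1)"
      using real_arch_pow_inv[of "e / (D + 1)" "1/2"] e D(2) by auto
    have "D * (1/2) ^ N \<le> (D + 1) * (1/2) ^ N"
      by (simp add: algebra_simps)
    also have "\<dots> < e"
      using N D(2) by (simp add: field_simps)
    finally have small: "D * (1/2) ^ N < e" .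
    have near: "nrm (?S n \<ominus> ?S N) < e" if "n \<ge> N" for n
      using tail[of N "n - N"] that small by simp
    have "nrm (?S n \<ominus> ?S m) < e" if "n \<ge> N" "m \<ge> N" for n m
      using near[OF that(1)] near[OF that(2)] nrm_diff_triangle[OF S[of n] S[of N] S[of m]]
        nrm_minus_commute[OF S[of N] S[of m]] by simp
    then show ?thesis by blast
  qed
  then obtain l where l: "l \<in> carrier R" "\<And>e. e > 0 \<Longrightarrow> \<exists>N. \<forall>n\<ge>N. nrm (?S n \<ominus> l) < e"
    by (rule Cauchy_converges[of ?S, OF S]) (assumption, rule that)
  have "nrm (l \<ominus> ?S n) \<le> D * (1/2) ^ n" for n
  proof (rule field_le_epsilon)
    fix e :: real assume e: "e > 0"
    then obtain N where N: "\<And>m. m \<ge> N \<Longrightarrow> nrm (?S m \<ominus> l) < e"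
      using l(2) by blast
    have "nrm (l \<ominus> ?S n) \<le> max (nrm (l \<ominus> ?S (n + N))) (nrm (?S (n + N) \<ominus> ?S n))"
      by (rule nrm_diff_triangle[OF l(1) S S])
    also have "\<dots> \<le> D * (1/2) ^ n + e"
      using N[of "n + N"] tail[of n N] nrm_minus_commute[OF l(1) S, of "n + N"] D(2) e
      by (simp add: add_increasing)
    finally show "nrm (l \<ominus> ?S n) \<le> D * (1/2) ^ n + e" .
  qed
  with l(1) that show ?thesis by blast
qed

text \<open>If every element of \<open>M\<close> is a linear combination up to an error of half its norm that lies again in
  \<open>M\<close>, then the errors can be expanded in turn.  The coefficients form geometric series, and by the
  ultrametric inequality their sums obey the bound of the first term.\<close>

lemma successive_approximation:
  assumes F: "finite F" "w \<in> F \<rightarrow> carrier R" and M: "M \<subseteq> carrier R" and C: "0 \<le> C"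
    and approx: "\<And>x. x \<in> M \<Longrightarrow> \<exists>b\<in>F \<rightarrow> carrier R. (\<forall>i\<in>F. nrm (b i) \<le> C * nrm x) \<and>
        x \<ominus> lincomb R F w b \<in> M \<and> nrm (x \<ominus> lincomb R F w b) \<le> nrm x / 2"
    and x: "x \<in> M"
  shows "\<exists>b\<in>F \<rightarrow> carrier R. (\<forall>i\<in>F. nrm (b i) \<le> C * nrm x) \<and> x = lincomb R F w b"
proof -
  obtain \<beta> where \<beta>: "\<And>x. x \<in> M \<Longrightarrow> \<beta> x \<in> F \<rightarrow> carrier R"
      "\<And>x i. x \<in> M \<Longrightarrow> i \<in> F \<Longrightarrow> nrm (\<beta> x i) \<le> C * nrm x"
      "\<And>x. x \<in> M \<Longrightarrow> x \<ominus> lincomb R F w (\<beta> x) \<in> M"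
      "\<And>x. x \<in> M \<Longrightarrow> nrm (x \<ominus> lincomb R F w (\<beta> x)) \<le> nrm x / 2"
    using approx by metis
  \<comment> \<open>the error left after \<open>k\<close> rounds\<close>
  define r where "r k = ((\<lambda>x. x \<ominus> lincomb R F w (\<beta> x)) ^^ k) x" for k
  have r_Suc: "r (Suc k) = r k \<ominus> lincomb R F w (\<beta> (r k))" for k
    by (simp add: r_def)
  have r_mem: "r k \<in> M" for k
  proof (induction k)
    case 0 show ?case using x by (simp add: r_def)
  next
    case (Suc k) then show ?case unfolding r_Suc by (rule \<beta>(3))
  qed
  have r_le: "nrm (r k) \<le> nrm x * (1/2) ^ k" for k
  proof (induction k)
    case 0 show ?case by (simp add: r_def)
  next
    case (Suc k) then show ?case unfolding r_Suc using \<beta>(4)[OF r_mem[of k]] by simp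
  qed
  have x_carr: "x \<in> carrier R" and r_carr: "r k \<in> carrier R" for k
    using x r_mem M by auto
  have b: "\<beta> (r k) i \<in> carrier R" if "i \<in> F" for k i
    using \<beta>(1)[OF r_mem] that by auto
  have b_le: "nrm (\<beta> (r k) i) \<le> (C * nrm x) * (1/2) ^ k" if "i \<in> F" for k i
    using \<beta>(2)[OF r_mem that, of k] mult_left_mono[OF r_le[of k] C] by (simp add: mult.assoc)
  have D: "0 \<le> C * nrm x"
    using C nrm_nonneg[OF x_carr] by simp
  let ?S = "\<lambda>n i. \<Oplus>k\<in>{..<n}. \<beta> (r k) i"
  have S: "?S n \<in> F \<rightarrow> carrier R" for n
    using b by (auto intro!: finsum_closed)
  have "\<exists>l\<in>carrier R. \<forall>n. nrm (l \<ominus> ?S n i) \<le> (C * nrm x) * (1/2) ^ n" if i: "i \<in> F" for i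
    by (rule geometric_series_converges[OF b[OF i] b_le[OF i] D]) blast
  then obtain B where B: "\<And>i. i \<in> F \<Longrightarrow> B i \<in> carrier R"
      "\<And>i n. i \<in> F \<Longrightarrow> nrm (B i \<ominus> ?S n i) \<le> (C * nrm x) * (1/2) ^ n"
    by metis
  have B_carr: "B \<in> F \<rightarrow> carrier R"
    using B(1) by auto
  have rem: "x \<ominus> lincomb R F w (?S n) = r n" for n
  proof (induction n)
    case 0
    show ?case
      using x_carr lincomb_zero[OF F(2)] by (simp add: r_def minus_eq)
  next
    case (Suc n)
    have "?S (Suc n) i = ?S n i \<oplus> \<beta> (r n) i" if "i \<in> F" for i
      using b[OF that] S[of n] that by (simp add: lessThan_Suc finsum_insert a_comm Pi_iff)
    then have "lincomb R F w (?S (Suc n)) = lincomb R F w (\<lambda>i. ?S n i \<oplus> \<beta> (r n) i)"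
      unfolding lincomb_def using F b S[of n] by (intro finsum_cong' refl) (auto simp: Pi_iff)
    also have "\<dots> = lincomb R F w (?S n) \<oplus> lincomb R F w (\<beta> (r n))"
      by (rule lincomb_add[OF S \<beta>(1)[OF r_mem] F(2)])
    moreover have "x \<ominus> (y \<oplus> z) = (x \<ominus> y) \<ominus> z" if "y \<in> carrier R" "z \<in> carrier R" for y z
      using that x_carr by algebra
    ultimately have "x \<ominus> lincomb R F w (?S (Suc n)) =
        (x \<ominus> lincomb R F w (?S n)) \<ominus> lincomb R F w (\<beta> (r n))"
      using lincomb_closed[OF S F(2), of n] lincomb_closed[OF \<beta>(1)[OF r_mem] F(2), of n] by simp
    then show ?case
      unfolding Suc.IH r_Suc .
  qed
  define G where "G = (\<Sum>i\<in>F. nrm (w i))"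
  have G: "0 \<le> G" "\<And>i. i \<in> F \<Longrightarrow> nrm (w i) \<le> G"
    unfolding G_def using F nrm_nonneg by (auto intro!: sum_nonneg member_le_sum simp: Pi_iff)
  let ?E = "nrm x * max 1 (C * G)"
  have "nrm (x \<ominus> lincomb R F w B) \<le> ?E * (1/2) ^ n" for n
  proof -
    have cl: "lincomb R F w (?S n) \<in> carrier R" "lincomb R F w B \<in> carrier R"
      using lincomb_closed[OF S F(2)] lincomb_closed[OF B_carr F(2)] by auto
    have "nrm (x \<ominus> lincomb R F w B) \<le>
        max (nrm (x \<ominus> lincomb R F w (?S n))) (nrm (lincomb R F w (?S n) \<ominus> lincomb R F w B))"
      by (rule nrm_diff_triangle[OF x_carr cl])
    moreover have "nrm (x \<ominus> lincomb R F w (?S n)) \<le> ?E * (1/2) ^ n"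
    proof -
      have "nrm x * 1 \<le> ?E"
        using nrm_nonneg[OF x_carr] by (intro mult_left_mono) auto
      then have "nrm x * (1/2) ^ n \<le> ?E * (1/2) ^ n"
        by (intro mult_right_mono) auto
      then show ?thesis
        unfolding rem using r_le[of n] by linarith
    qed
    moreover have "nrm (lincomb R F w (?S n) \<ominus> lincomb R F w B) \<le> ?E * (1/2) ^ n"
    proof -
      have "nrm (lincomb R F w (\<lambda>i. B i \<ominus> ?S n i)) \<le> ((C * nrm x) * (1/2) ^ n) * G"
      proof (rule nrm_lincomb_le[OF F(1) _ F(2)])
        show "(\<lambda>i. B i \<ominus> ?S n i) \<in> F \<rightarrow> carrier R"
          using B S[of n] by (auto simp: Pi_iff)
        show "nrm (B i \<ominus> ?S n i) * nrm (w i) \<le> ((C * nrm x) * (1/2) ^ n) * G" if i: "i \<in> F" for i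
          using B G F i D by (intro mult_mono) (auto intro!: nrm_nonneg)
      qed (use D G in auto)
      also have "\<dots> = nrm x * (C * G) * (1/2) ^ n"
        by simp
      also have "\<dots> \<le> ?E * (1/2) ^ n"
        using nrm_nonneg[OF x_carr] by (intro mult_right_mono mult_left_mono) auto
      finally show ?thesis
        using nrm_minus_commute[OF cl] lincomb_diff[OF F(1) B_carr S F(2)] by simp
    qed
    ultimately show ?thesis by simp
  qed
  moreover have "(\<lambda>n. ?E * (1/2) ^ n) \<longlonglongrightarrow> ?E * 0"
    by (intro tendsto_intros LIMSEQ_power_zero) auto
  ultimately have "nrm (x \<ominus> lincomb R F w B) \<le> 0"
    by (intro tendsto_lowerbound[where f = "\<lambda>n. ?E * (1/2) ^ n"]) auto
  then have "x = lincomb R F w B"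
    using nrm_eq_zero[of "x \<ominus> lincomb R F w B"] nrm_nonneg[of "x \<ominus> lincomb R F w B"]
      x_carr lincomb_closed[OF B_carr F(2)] by (simp add: r_right_minus_eq)
  moreover have "nrm (B i) \<le> C * nrm x" if "i \<in> F" for i
    using B(2)[OF that, of 0] B(1)[OF that] by (simp add: minus_eq)
  ultimately show ?thesis
    using B_carr by blast
qed

end

lemma exists_powi_between:
  fixes p t :: real
  assumes "0 < p" "p < 1" "0 < t"
  obtains k :: int where "p powi k \<le> t" "p * t < p powi k"
proof -
  let ?l = "log p t"
  have t: "t = p powr ?l"
    using assms by simp
  have pw: "p powi k = p powr (real_of_int k)" for k
    using assms by (simp add: powr_real_of_int')
  have "p powr real_of_int \<lceil>?l\<rceil> \<le> p powr ?l"
    using assms by (intro powr_mono') auto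
  moreover have "p powr (1 + ?l) < p powr real_of_int \<lceil>?l\<rceil>"
  proof -
    have "real_of_int \<lceil>?l\<rceil> < 1 + ?l"
      using ceiling_correct[of ?l] by linarith
    then show ?thesis
      using assms by (simp add: powr_less_mono')
  qed
  moreover have "p powr (1 + ?l) = p * t"
    using assms by (simp add: powr_add)
  ultimately show ?thesis
    using that[of "\<lceil>?l\<rceil>"] t pw by simp
qed

context complete_tate_ring
begin

lemma pi_pos: "0 < nrm \<pi>"
proof (rule ccontr)
  assume "\<not> ?thesis"
  then have "nrm \<pi> = 0"
    using nrm_nonneg[of \<pi>] pi_unit by (simp add: Units_closed)
  then have "nrm (\<pi> \<otimes> inv \<pi>) = 0"
    using nrm_pi_mult[of "inv \<pi>"] pi_unit by simp
  then show False
    using pi_unit nrm_one by simp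
qed

lemma scaling_unit:
  obtains u v where "u \<in> carrier R" "v \<in> carrier R" "v \<otimes> u = \<one>"
    "\<And>x. x \<in> carrier R \<Longrightarrow> nrm (u \<otimes> x) = nrm \<pi> powi k * nrm x"
    "\<And>x. x \<in> carrier R \<Longrightarrow> nrm (v \<otimes> x) = nrm \<pi> powi (- k) * nrm x"
proof -
  have pi: "\<pi> \<in> carrier R" "inv \<pi> \<in> carrier R" "inv \<pi> \<otimes> \<pi> = \<one>"
    using pi_unit by (auto simp: Units_closed)
  have nat: "\<exists>u v. u \<in> carrier R \<and> v \<in> carrier R \<and> v \<otimes> u = \<one> \<and>
      (\<forall>x\<in>carrier R. nrm (u \<otimes> x) = nrm \<pi> ^ n * nrm x) \<and>
      (\<forall>x\<in>carrier R. nrm (v \<otimes> x) = nrm x / nrm \<pi> ^ n)" for n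
  proof (induction n)
    case 0
    then show ?case by (intro exI[of _ \<one>]) auto
  next
    case (Suc n)
    then obtain u v where u: "u \<in> carrier R" "\<And>x. x \<in> carrier R \<Longrightarrow> nrm (u \<otimes> x) = nrm \<pi> ^ n * nrm x"
      and v: "v \<in> carrier R" "\<And>x. x \<in> carrier R \<Longrightarrow> nrm (v \<otimes> x) = nrm x / nrm \<pi> ^ n"
      and vu: "v \<otimes> u = \<one>"
      by blast
    have inv: "nrm (inv \<pi> \<otimes> x) = nrm x / nrm \<pi>" if x: "x \<in> carrier R" for x
    proof -
      have "\<pi> \<otimes> (inv \<pi> \<otimes> x) = x"
        using x pi pi_unit by (simp flip: m_assoc)
      then show ?thesis
        using nrm_pi_mult[of "inv \<pi> \<otimes> x"] x pi pi_pos by (simp add: field_simps)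
    qed
    have "(inv \<pi> \<otimes> v) \<otimes> (\<pi> \<otimes> u) = (inv \<pi> \<otimes> \<pi>) \<otimes> (v \<otimes> u)"
      using u(1) v(1) pi(1,2) by algebra
    then have "(inv \<pi> \<otimes> v) \<otimes> (\<pi> \<otimes> u) = \<one>"
      using vu pi by simp
    moreover have "nrm (\<pi> \<otimes> u \<otimes> x) = nrm \<pi> ^ Suc n * nrm x" if "x \<in> carrier R" for x
      using that u pi by (simp add: m_assoc nrm_pi_mult)
    moreover have "nrm (inv \<pi> \<otimes> v \<otimes> x) = nrm x / nrm \<pi> ^ Suc n" if "x \<in> carrier R" for x
      using that v pi pi_pos by (simp add: m_assoc inv field_simps)
    ultimately show ?case
      using u v pi by (intro exI[of _ "\<pi> \<otimes> u"] exI[of _ "inv \<pi> \<otimes> v"]) auto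
  qed
  show ?thesis
  proof (cases "k \<ge> 0")
    case True
    then obtain n where "k = int n" by (metis nonneg_int_cases)
    with nat[of n] that show ?thesis
      by (auto simp: power_int_minus field_simps)
  next
    case False
    define n where "n = nat (- k)"
    with False have k: "k = - int n" by simp
    from nat[of n] obtain u v where uv: "u \<in> carrier R" "v \<in> carrier R" "v \<otimes> u = \<one>"
      "\<And>x. x \<in> carrier R \<Longrightarrow> nrm (u \<otimes> x) = nrm \<pi> ^ n * nrm x"
      "\<And>x. x \<in> carrier R \<Longrightarrow> nrm (v \<otimes> x) = nrm x / nrm \<pi> ^ n"
      by blast
    show ?thesis
      by (rule that[of v u]) (use uv k in \<open>auto simp: m_comm power_int_minus field_simps\<close>)
  qed
qed

text \<open>The sets \<open>U k\<close> of linear combinations with coefficients of norm at most \<open>k\<close> cover \<open>M\<close>, so the closure of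
  one of them contains a ball of \<open>M\<close>.  As \<open>U k\<close> is an additive group (the norm is ultrametric), the ball
  can be moved to the origin without changing \<open>k\<close>.\<close>

lemma Baire_bounded_approximation:
  assumes M: "ideal M R" "norm_closure R nrm M \<subseteq> M"
    and F: "finite F" "w \<in> F \<rightarrow> M"
    and gen: "\<And>x. x \<in> M \<Longrightarrow> \<exists>b\<in>F \<rightarrow> carrier R. x = lincomb R F w b"
  obtains \<delta> B where "\<delta> > 0" "B \<ge> 0"
    "\<And>x \<eta>. x \<in> M \<Longrightarrow> nrm x < \<delta> \<Longrightarrow> \<eta> > 0 \<Longrightarrow>
       \<exists>b\<in>F \<rightarrow> carrier R. (\<forall>i\<in>F. nrm (b i) \<le> B) \<and> nrm (x \<ominus> lincomb R F w b) < \<eta>"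
proof -
  interpret I: ideal M R by (rule M)
  have wc: "w \<in> F \<rightarrow> carrier R"
    using F(2) I.a_subset by auto
  interpret A: Metric_space "carrier R" "norm_dist R nrm"
    by (rule Metric_space_norm_dist)
  interpret S: Submetric "carrier R" "norm_dist R nrm" M
    using I.a_subset by unfold_locales
  define U where "U k = {lincomb R F w b | b. b \<in> F \<rightarrow> carrier R \<and> (\<forall>i\<in>F. nrm (b i) \<le> real k)}" for k :: nat
  have U_sub: "U k \<subseteq> M" for k
    using lincomb_in_ideal[OF M(1) F(1) _ F(2)] by (auto simp: U_def)
  have "A.mtopology closure_of M \<subseteq> M"
  proof
    fix x assume x: "x \<in> A.mtopology closure_of M"
    then have "x \<in> norm_closure R nrm M"
      using I.Icarr unfolding A.metric_closure_of norm_closure_def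
      by (fastforce simp: A.in_mball norm_dist_def)
    with M(2) show "x \<in> M" by blast
  qed
  then have "closedin A.mtopology M"
    using I.a_subset closure_of_subset_eq[of M A.mtopology] by simp
  then have S_complete: "S.sub.mcomplete"
    using S.closedin_eq_mcomplete complete by (simp add: norm_complete_def)
  have cover: "M \<subseteq> (\<Union>k. U k)"
  proof
    fix x assume "x \<in> M"
    then obtain b where b: "b \<in> F \<rightarrow> carrier R" "x = lincomb R F w b"
      using gen by blast
    have "\<forall>i\<in>F. nrm (b i) \<le> real (nat \<lceil>\<Sum>i\<in>F. nrm (b i)\<rceil>)"
    proof
      fix i assume i: "i \<in> F"
      have "nrm (b i) \<le> (\<Sum>i\<in>F. nrm (b i))"
        using F(1) i b nrm_nonneg by (intro member_le_sum) (auto simp: Pi_iff)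
      then show "nrm (b i) \<le> real (nat \<lceil>\<Sum>i\<in>F. nrm (b i)\<rceil>)"
        using real_nat_ceiling_ge[of "\<Sum>i\<in>F. nrm (b i)"] by linarith
    qed
    with b show "x \<in> (\<Union>k. U k)"
      by (auto simp: U_def)
  qed
  have "\<exists>k. S.sub.mtopology interior_of (S.sub.mtopology closure_of (U k)) \<noteq> {}"
  proof (rule ccontr)
    assume none: "\<not> ?thesis"
    let ?\<G> = "range (\<lambda>k. S.sub.mtopology closure_of (U k))"
    have "S.sub.mtopology interior_of \<Union>?\<G> = {}"
      by (rule S.sub.metric_Baire_category_alt) (use none S_complete in auto)
    moreover have "\<Union>?\<G> = M"
    proof
      show "\<Union>?\<G> \<subseteq> M"
        using closure_of_subset_topspace[of S.sub.mtopology] by auto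
      show "M \<subseteq> \<Union>?\<G>"
      proof
        fix x assume "x \<in> M"
        then obtain k where "x \<in> U k"
          using cover by blast
        moreover have "U k \<subseteq> S.sub.mtopology closure_of (U k)"
          using U_sub by (intro closure_of_subset) auto
        ultimately show "x \<in> \<Union>?\<G>"
          by (intro UnionI[OF rangeI[of _ k]]) auto
      qed
    qed
    ultimately have "M = {}"
      using interior_of_topspace[of S.sub.mtopology] by simp
    then show False
      using I.zero_closed by blast
  qed
  then obtain k x0 \<delta> where \<delta>: "\<delta> > 0" and x0: "x0 \<in> M"
    and ball: "S.sub.mball x0 \<delta> \<subseteq> S.sub.mtopology closure_of (U k)"
    unfolding S.sub.metric_interior_of by blast
  have near: "\<exists>b\<in>F \<rightarrow> carrier R. (\<forall>i\<in>F. nrm (b i) \<le> real k) \<and> nrm (y \<ominus> lincomb R F w b) < \<eta>"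
    if y: "y \<in> M" "nrm (x0 \<ominus> y) < \<delta>" and \<eta>: "\<eta> > 0" for y \<eta>
  proof -
    have "y \<in> S.sub.mball x0 \<delta>"
      using y x0 I.Icarr by (simp add: S.sub.in_mball norm_dist_def)
    then have "y \<in> S.sub.mtopology closure_of (U k)"
      using ball by blast
    then obtain z where "z \<in> U k" "norm_dist R nrm y z < \<eta>"
      using \<eta> unfolding S.sub.metric_closure_of by (auto simp: S.sub.in_mball)
    moreover from this(1) have "z \<in> M"
      using U_sub by blast
    then have "z \<in> carrier R" "y \<in> carrier R"
      using I.Icarr y by auto
    ultimately show ?thesis
      by (auto simp: U_def norm_dist_def)
  qed
  show ?thesis
  proof (rule that[OF \<delta>, of "real k"])
    fix x \<eta> assume x: "x \<in> M" "nrm x < \<delta>" and \<eta>: "\<eta> > (0::real)"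
    have c: "x \<in> carrier R" "x0 \<in> carrier R"
      using x x0 I.Icarr by auto
    have "x0 \<ominus> (x0 \<oplus> x) = \<ominus> x"
      using c by algebra
    then have "nrm (x0 \<ominus> (x0 \<oplus> x)) < \<delta>"
      using x c by (simp add: nrm_minus)
    from near[OF I.a_closed[OF x0 x(1)] this \<eta>] obtain b
      where b: "b \<in> F \<rightarrow> carrier R" "\<forall>i\<in>F. nrm (b i) \<le> real k"
        "nrm ((x0 \<oplus> x) \<ominus> lincomb R F w b) < \<eta>"
      by blast
    from near[OF x0 _ \<eta>] \<delta> obtain b0
      where b0: "b0 \<in> F \<rightarrow> carrier R" "\<forall>i\<in>F. nrm (b0 i) \<le> real k"
        "nrm (x0 \<ominus> lincomb R F w b0) < \<eta>"
      using nrm_diff_self[OF c(2)] by auto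
    have lc: "lincomb R F w b \<in> carrier R" "lincomb R F w b0 \<in> carrier R"
      using lincomb_closed[OF _ wc] b b0 by auto
    have "x \<ominus> (p \<ominus> q) = ((x0 \<oplus> x) \<ominus> p) \<ominus> (x0 \<ominus> q)" if "p \<in> carrier R" "q \<in> carrier R" for p q
      using c that by algebra
    then have "nrm (x \<ominus> lincomb R F w (\<lambda>i. b i \<ominus> b0 i)) \<le>
        max (nrm ((x0 \<oplus> x) \<ominus> lincomb R F w b)) (nrm (x0 \<ominus> lincomb R F w b0))"
      using nrm_diff[of "(x0 \<oplus> x) \<ominus> lincomb R F w b" "x0 \<ominus> lincomb R F w b0"] lc c
        lincomb_diff[OF F(1) b(1) b0(1) wc] by simp
    moreover have "nrm (b i \<ominus> b0 i) \<le> real k" if i: "i \<in> F" for i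
      using nrm_diff[of "b i" "b0 i"] i b(1,2) b0(1,2) by (force simp: Pi_iff)
    ultimately show "\<exists>b\<in>F \<rightarrow> carrier R. (\<forall>i\<in>F. nrm (b i) \<le> real k) \<and> nrm (x \<ominus> lincomb R F w b) < \<eta>"
      using b b0 by (intro bexI[of _ "\<lambda>i. b i \<ominus> b0 i"]) (auto simp: Pi_iff)
  qed simp
qed

text \<open>This is the open mapping theorem for the map from coefficients to elements of \<open>M\<close>.  Scaling by powers
  of the uniformizer turns the approximation near the origin into one with an error of half the norm
  everywhere; successive approximation then makes it exact.\<close>

lemma bounded_generation:
  assumes M: "ideal M R" "norm_closure R nrm M \<subseteq> M"
    and F: "finite F" "w \<in> F \<rightarrow> M"
    and gen: "\<And>x. x \<in> M \<Longrightarrow> \<exists>b\<in>F \<rightarrow> carrier R. x = lincomb R F w b"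
  obtains C where "C > 0"
    "\<And>x. x \<in> M \<Longrightarrow> \<exists>b\<in>F \<rightarrow> carrier R. (\<forall>i\<in>F. nrm (b i) \<le> C * nrm x) \<and> x = lincomb R F w b"
proof -
  interpret I: ideal M R by (rule M)
  have wc: "w \<in> F \<rightarrow> carrier R"
    using F(2) I.a_subset by auto
  obtain \<delta> B where \<delta>: "\<delta> > 0" and B: "B \<ge> 0"
    and near: "\<And>x \<eta>. x \<in> M \<Longrightarrow> nrm x < \<delta> \<Longrightarrow> \<eta> > 0 \<Longrightarrow>
       \<exists>b\<in>F \<rightarrow> carrier R. (\<forall>i\<in>F. nrm (b i) \<le> B) \<and> nrm (x \<ominus> lincomb R F w b) < \<eta>"
    by (rule Baire_bounded_approximation[OF M F gen]) (assumption, rule that)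
  define C where "C = 2 * (B + 1) / (nrm \<pi> * \<delta>)"
  have C: "C > 0"
    using B \<delta> pi_pos by (simp add: C_def)
  have "\<exists>b\<in>F \<rightarrow> carrier R. (\<forall>i\<in>F. nrm (b i) \<le> C * nrm x) \<and>
      x \<ominus> lincomb R F w b \<in> M \<and> nrm (x \<ominus> lincomb R F w b) \<le> nrm x / 2" if x: "x \<in> M" for x
  proof -
    have xc: "x \<in> carrier R"
      using I.Icarr[OF x] .
    have rest: "x \<ominus> lincomb R F w b \<in> M" if "b \<in> F \<rightarrow> carrier R" for b
      using lincomb_in_ideal[OF M(1) F(1) that F(2)] x by (simp add: minus_eq)
    show ?thesis
    proof (cases "x = \<zero>")
      case True
      then show ?thesis
        using rest[of "\<lambda>i. \<zero>"] lincomb_zero[OF wc]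
        by (intro bexI[of _ "\<lambda>i. \<zero>"]) (auto simp: nrm_zero minus_eq)
    next
      case False
      then have pos: "nrm x > 0"
        using nrm_nonneg[OF xc] nrm_eq_zero[OF xc] by fastforce
      \<comment> \<open>scale \<open>x\<close> to norm at most \<open>\<delta> / 2\<close>, but more than \<open>\<bar>\<pi>\<bar> * \<delta> / 2\<close>; the second bound controls the
        coefficients after scaling back\<close>
      then obtain k where k: "nrm \<pi> powi k \<le> \<delta> / (2 * nrm x)" "nrm \<pi> * (\<delta> / (2 * nrm x)) < nrm \<pi> powi k"
        using exists_powi_between[OF pi_pos pi_small, of "\<delta> / (2 * nrm x)"] \<delta> by auto
      let ?r = "nrm \<pi> powi k"
      have r: "?r > 0"
        using pi_pos by simp
      obtain u v where uv: "u \<in> carrier R" "v \<in> carrier R" "v \<otimes> u = \<one>"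
        and u: "\<And>x. x \<in> carrier R \<Longrightarrow> nrm (u \<otimes> x) = ?r * nrm x"
        and v': "\<And>x. x \<in> carrier R \<Longrightarrow> nrm (v \<otimes> x) = nrm \<pi> powi (- k) * nrm x"
        by (rule scaling_unit[of k]) (rule that)
      have v: "nrm (v \<otimes> y) = nrm y / ?r" if "y \<in> carrier R" for y
        using v'[OF that] by (simp add: power_int_minus field_simps)
      have "nrm (u \<otimes> x) < \<delta>"
      proof -
        have "?r * nrm x \<le> \<delta> / 2"
          using k(1) pos by (simp add: field_simps)
        then show ?thesis
          using u[OF xc] \<delta> by simp
      qed
      moreover have "u \<otimes> x \<in> M"
        using x uv by (intro I.I_l_closed)
      ultimately obtain b where b: "b \<in> F \<rightarrow> carrier R" "\<forall>i\<in>F. nrm (b i) \<le> B"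
          "nrm (u \<otimes> x \<ominus> lincomb R F w b) < ?r * (nrm x / 2)"
        using near[of "u \<otimes> x" "?r * (nrm x / 2)"] r pos by auto
      let ?b = "\<lambda>i. v \<otimes> b i"
      have lc: "lincomb R F w b \<in> carrier R"
        by (rule lincomb_closed[OF b(1) wc])
      have b': "?b \<in> F \<rightarrow> carrier R"
        using b(1) uv by (auto simp: Pi_iff)
      have "nrm (?b i) \<le> C * nrm x" if i: "i \<in> F" for i
      proof -
        have "nrm (?b i) \<le> B / ?r"
          using b(1,2) i v r by (auto simp: Pi_iff divide_right_mono)
        also have "\<dots> \<le> (B + 1) / (nrm \<pi> * (\<delta> / (2 * nrm x)))"
          using k(2) B \<delta> pos pi_pos by (intro frac_le) auto
        also have "\<dots> = C * nrm x"
          by (simp add: C_def)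
        finally show ?thesis .
      qed
      moreover have "nrm (x \<ominus> lincomb R F w ?b) \<le> nrm x / 2"
      proof -
        have vux: "v \<otimes> (u \<otimes> x) = x"
          using uv xc by (simp flip: m_assoc)
        have "v \<otimes> (u \<otimes> x \<ominus> y) = v \<otimes> (u \<otimes> x) \<ominus> v \<otimes> y" if "y \<in> carrier R" for y
          using that uv xc by algebra
        then have "x \<ominus> lincomb R F w ?b = v \<otimes> (u \<otimes> x \<ominus> lincomb R F w b)"
          using lincomb_scale[OF F(1) uv(2) b(1) wc] lc vux by simp
        then have "nrm (x \<ominus> lincomb R F w ?b) = nrm (u \<otimes> x \<ominus> lincomb R F w b) / ?r"
          using v[of "u \<otimes> x \<ominus> lincomb R F w b"] lc uv xc by simp
        also have "\<dots> \<le> nrm x / 2"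
          using b(3) r by (simp add: field_simps)
        finally show ?thesis .
      qed
      ultimately show ?thesis
        using rest[OF b'] by (intro bexI[OF _ b']) auto
    qed
  qed
  then have "\<exists>b\<in>F \<rightarrow> carrier R. (\<forall>i\<in>F. nrm (b i) \<le> C * nrm x) \<and> x = lincomb R F w b" if "x \<in> M" for x
    using successive_approximation[OF F(1) wc I.a_subset less_imp_le[OF C]] that by blast
  with C that show ?thesis by blast
qed

end

section \<open>Ideals of complete Noetherian rings\<close>

context complete_tate_ring
begin

text \<open>The closure \<open>M\<close> of \<open>I\<close> has finitely many generators, each approximated by an element of \<open>I\<close>.  Because \<open>M\<close>
  is generated with bounded coefficients, replacing the generators by these approximations changes an
  element of \<open>M\<close> by at most half its norm.  By successive approximation the elements chosen in \<open>I\<close>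
  generate \<open>M\<close>.\<close>

lemma noetherian_ideal_closed:
  assumes noeth: "noetherian_ring R" and I: "ideal I R"
  shows "norm_closure R nrm I \<subseteq> I"
proof -
  interpret I: ideal I R by (rule I)
  let ?M = "norm_closure R nrm I"
  have M: "ideal ?M R" "norm_closure R nrm ?M \<subseteq> ?M"
    using ideal_norm_closure[OF I] norm_closure_idem[OF I.a_subset] by auto
  interpret M: ideal ?M R by (rule M)
  obtain F where F: "F \<subseteq> carrier R" "finite F" "?M = Idl F"
    using noetherian_ring.finetely_gen[OF noeth M(1)] by blast
  have FM: "(\<lambda>g. g) \<in> F \<rightarrow> ?M"
    using genideal_self[OF F(1)] F(3) by auto
  have gen: "\<exists>b\<in>F \<rightarrow> carrier R. x = lincomb R F (\<lambda>g. g) b" if "x \<in> ?M" for x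
    using genideal_eq_lincombs[OF F(2,1)] that F(3) by metis
  obtain C where C: "C > 0" and bdd: "\<And>x. x \<in> ?M \<Longrightarrow>
      \<exists>b\<in>F \<rightarrow> carrier R. (\<forall>i\<in>F. nrm (b i) \<le> C * nrm x) \<and> x = lincomb R F (\<lambda>g. g) b"
    by (rule bounded_generation[OF M F(2) FM gen]) (assumption, rule that)
  have "\<exists>y\<in>I. nrm (g \<ominus> y) < 1 / (2 * C)" if "g \<in> F" for g
  proof -
    have "g \<in> ?M" "1 / (2 * C) > 0"
      using FM that C by auto
    then show ?thesis
      unfolding norm_closure_def by blast
  qed
  then obtain \<gamma> where \<gamma>: "\<And>g. g \<in> F \<Longrightarrow> \<gamma> g \<in> I" "\<And>g. g \<in> F \<Longrightarrow> nrm (g \<ominus> \<gamma> g) < 1 / (2 * C)"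
    by metis
  have \<gamma>M: "\<gamma> \<in> F \<rightarrow> ?M" and \<gamma>c: "\<gamma> \<in> F \<rightarrow> carrier R"
    using \<gamma>(1) subset_norm_closure[OF I.a_subset] I.Icarr by auto
  show ?thesis
  proof
    fix x assume x: "x \<in> ?M"
    have "\<exists>b\<in>F \<rightarrow> carrier R. (\<forall>i\<in>F. nrm (b i) \<le> C * nrm x) \<and> x = lincomb R F \<gamma> b"
    proof (rule successive_approximation[OF F(2) \<gamma>c M.a_subset less_imp_le[OF C] _ x])
      fix y assume y: "y \<in> ?M"
      then have yc: "y \<in> carrier R"
        by (rule M.Icarr)
      obtain b where b: "b \<in> F \<rightarrow> carrier R" "\<forall>i\<in>F. nrm (b i) \<le> C * nrm y" "y = lincomb R F (\<lambda>g. g) b"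
        using bdd[OF y] by blast
      have diff: "y \<ominus> lincomb R F \<gamma> b = lincomb R F (\<lambda>g. g \<ominus> \<gamma> g) b"
        unfolding b(3) using F(1) by (intro lincomb_diff_family[OF F(2) b(1) _ \<gamma>c]) auto
      have "nrm (lincomb R F (\<lambda>g. g \<ominus> \<gamma> g) b) \<le> nrm y / 2"
      proof (rule nrm_lincomb_le[OF F(2) b(1)])
        show "(\<lambda>g. g \<ominus> \<gamma> g) \<in> F \<rightarrow> carrier R"
          using F(1) \<gamma>c by (auto simp: Pi_iff)
        show "nrm (b g) * nrm (g \<ominus> \<gamma> g) \<le> nrm y / 2" if g: "g \<in> F" for g
        proof -
          have "nrm (b g) * nrm (g \<ominus> \<gamma> g) \<le> (C * nrm y) * (1 / (2 * C))"
            using b(2) \<gamma>(2)[OF g] g C nrm_nonneg[OF yc] F(1) \<gamma>c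
            by (intro mult_mono) (auto intro!: nrm_nonneg simp: Pi_iff)
          then show ?thesis
            using C by simp
        qed
      qed (use nrm_nonneg[OF yc] in auto)
      moreover have "y \<ominus> lincomb R F \<gamma> b \<in> ?M"
        using lincomb_in_ideal[OF M(1) F(2) b(1) \<gamma>M] y by (simp add: minus_eq)
      ultimately show "\<exists>b\<in>F \<rightarrow> carrier R. (\<forall>i\<in>F. nrm (b i) \<le> C * nrm y) \<and>
          y \<ominus> lincomb R F \<gamma> b \<in> ?M \<and> nrm (y \<ominus> lincomb R F \<gamma> b) \<le> nrm y / 2"
        using b diff by auto
    qed
    then obtain b where b: "b \<in> F \<rightarrow> carrier R" "x = lincomb R F \<gamma> b"
      by blast
    show "x \<in> I"
      unfolding b(2) by (rule lincomb_in_ideal[OF I F(2) b(1)]) (use \<gamma>(1) in auto)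
  qed
qed

text \<open>The closed ideal \<open>P + (f)\<close> is generated by \<open>f\<close> and generators of \<open>P\<close> with bounded coefficients.  An
  element \<open>f g + j\<close> with \<open>j \<in> P\<close> and norm close to that of \<open>f g\<close> modulo \<open>P\<close> is therefore \<open>f g' + l\<close> with \<open>g'\<close>
  of controlled norm and \<open>l \<in> P\<close>; since \<open>P\<close> is prime, \<open>g' - g \<in> P\<close>.\<close>

lemma noetherian_multiplication_bounded_below:
  assumes noeth: "noetherian_ring R" and P: "primeideal P R" and f: "f \<in> carrier R" "f \<notin> P"
  obtains C where "C > 0"
    "\<And>g. g \<in> carrier R \<Longrightarrow> quotient_seminorm R nrm P g \<le> C * quotient_seminorm R nrm P (f \<otimes> g)"
proof -
  interpret P: primeideal P R by (rule P)
  let ?q = "quotient_seminorm R nrm P"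
  let ?M = "{p \<oplus> r \<otimes> f | p r. p \<in> P \<and> r \<in> carrier R}"
  have M: "ideal ?M R" "norm_closure R nrm ?M \<subseteq> ?M" and PM: "P \<subseteq> ?M" and fM: "f \<in> ?M"
    using ideal_adjoin[OF P.is_ideal f(1)] noetherian_ideal_closed[OF noeth] by blast+
  obtain F where F: "F \<subseteq> carrier R" "finite F" "P = Idl F"
    using noetherian_ring.finetely_gen[OF noeth P.is_ideal] by blast
  have FP: "F \<subseteq> P"
    using genideal_self[OF F(1)] F(3) by auto
  have fF: "f \<notin> F"
    using FP f by blast
  let ?F = "insert f F"
  have w: "(\<lambda>g. g) \<in> ?F \<rightarrow> ?M" "(\<lambda>g. g) \<in> ?F \<rightarrow> carrier R"
    using FP PM fM F(1) f(1) by auto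
  have split: "lincomb R ?F (\<lambda>g. g) b = b f \<otimes> f \<oplus> lincomb R F (\<lambda>g. g) b" if "b \<in> ?F \<rightarrow> carrier R" for b
    using lincomb_insert[OF F(2) fF that w(2)] .
  have gen: "\<exists>b\<in>?F \<rightarrow> carrier R. x = lincomb R ?F (\<lambda>g. g) b" if x: "x \<in> ?M" for x
  proof -
    obtain p r where pr: "p \<in> P" "r \<in> carrier R" "x = p \<oplus> r \<otimes> f"
      using x by blast
    obtain b where b: "b \<in> F \<rightarrow> carrier R" "p = lincomb R F (\<lambda>g. g) b"
      using genideal_eq_lincombs[OF F(2,1)] pr(1) F(3) by metis
    have upd: "b(f := r) \<in> ?F \<rightarrow> carrier R"
      using b pr by auto
    have "lincomb R F (\<lambda>g. g) (b(f := r)) = p"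
      unfolding b(2) lincomb_def using b(1) F(1) fF by (intro finsum_cong' refl) (auto simp: Pi_iff)
    then have "x = lincomb R ?F (\<lambda>g. g) (b(f := r))"
      using split[OF upd] pr P.Icarr f by (simp add: a_comm)
    with upd show ?thesis by blast
  qed
  obtain C where C: "C > 0" and bdd: "\<And>x. x \<in> ?M \<Longrightarrow>
      \<exists>b\<in>?F \<rightarrow> carrier R. (\<forall>i\<in>?F. nrm (b i) \<le> C * nrm x) \<and> x = lincomb R ?F (\<lambda>g. g) b"
    by (rule bounded_generation[OF M finite.insertI[OF F(2)] w(1) gen]) (assumption, rule that)
  have "?q g \<le> C * ?q (f \<otimes> g)" if g: "g \<in> carrier R" for g
  proof -
    have "?q g / C \<le> t" if t: "?q (f \<otimes> g) < t" for t
    proof -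
      obtain j where j: "j \<in> P" "nrm (f \<otimes> g \<oplus> j) < t"
        by (rule quotient_seminorm_nearly_attained[OF P.is_ideal t])
      have jc: "j \<in> carrier R"
        using P.Icarr[OF j(1)] .
      have "f \<otimes> g \<oplus> j = j \<oplus> g \<otimes> f"
        using f g jc by algebra
      then have mem: "f \<otimes> g \<oplus> j \<in> ?M"
        using j g by blast
      obtain b where b: "b \<in> ?F \<rightarrow> carrier R" "\<forall>i\<in>?F. nrm (b i) \<le> C * nrm (f \<otimes> g \<oplus> j)"
          "f \<otimes> g \<oplus> j = lincomb R ?F (\<lambda>g. g) b"
        using bdd[OF mem] by blast
      note eq = b(3)[unfolded split[OF b(1)]]
      have bf_le: "nrm (b f) \<le> C * nrm (f \<otimes> g \<oplus> j)"
        using b(2) by simp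
      have bf: "b f \<in> carrier R"
        using b(1) by auto
      have lP: "lincomb R F (\<lambda>g. g) b \<in> P"
        using b(1) FP by (intro lincomb_in_ideal[OF P.is_ideal F(2)]) auto
      have lc: "lincomb R F (\<lambda>g. g) b \<in> carrier R"
        using P.Icarr[OF lP] .
      have "f \<otimes> (b f \<ominus> g) = j \<ominus> l" if "l \<in> carrier R" "f \<otimes> g \<oplus> j = b f \<otimes> f \<oplus> l" for l
      proof -
        have "f \<otimes> (b f \<ominus> g) = (b f \<otimes> f \<oplus> l) \<ominus> l \<ominus> f \<otimes> g"
          using that(1) f(1) g bf by algebra
        also have "\<dots> = (f \<otimes> g \<oplus> j) \<ominus> l \<ominus> f \<otimes> g"
          unfolding that(2) ..
        also have "\<dots> = j \<ominus> l"
          using that(1) f(1) g jc by algebra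
        finally show ?thesis .
      qed
      then have "f \<otimes> (b f \<ominus> g) = j \<ominus> lincomb R F (\<lambda>g. g) b"
        using lc eq by blast
      also have "\<dots> \<in> P"
        using j(1) lP by (simp add: minus_eq)
      finally have "b f \<ominus> g \<in> P"
        using P.I_prime[of f "b f \<ominus> g"] f bf g by auto
      then have "?q g \<le> nrm (g \<oplus> (b f \<ominus> g))"
        by (rule quotient_seminorm_le[OF P.is_ideal g])
      also have "g \<oplus> (b f \<ominus> g) = b f"
        using bf g by algebra
      also have "nrm (b f) \<le> C * t"
        using bf_le mult_left_mono[OF less_imp_le[OF j(2)] less_imp_le[OF C]] by linarith
      finally show ?thesis
        using C by (simp add: field_simps)
    qed
    then have "?q g / C \<le> ?q (f \<otimes> g)"
      by (rule dense_ge)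
    then show ?thesis
      using C by (simp add: field_simps)
  qed
  with C that show ?thesis by blast
qed

text \<open>Multiplication by \<open>f \<notin> P\<close> shrinks the quotient norm by at most a factor \<open>C\<close>, so the powers of \<open>f\<close> cannot
  decay faster than \<open>1 / C ^ n\<close>, and the spectral seminorm of \<open>f\<close> is positive.\<close>

lemma noetherian_prime_spectrally_reduced:
  assumes noeth: "noetherian_ring R" and P: "primeideal P R"
  shows "spectrally_reduced R nrm P"
proof (rule spectrally_reducedI)
  interpret P: primeideal P R by (rule P)
  let ?q = "quotient_seminorm R nrm P"
  show "ideal P R" by (rule P.is_ideal)
  have "\<one> \<notin> P"
    using P.one_imp_carrier P.I_notcarr by auto
  then show far: "1 \<le> nrm (\<one> \<ominus> j)" if "j \<in> P" for j
    using closed_proper_ideal_far_from_one[OF P.is_ideal noetherian_ideal_closed[OF noeth P.is_ideal] _ that]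
    by blast
  interpret q: ring_seminorm R ?q
    by (rule ring_seminorm_quotient[OF P.is_ideal far])
  fix f assume f: "f \<in> carrier R" and zero: "spectral_seminorm R ?q f = 0"
  show "f \<in> P"
  proof (rule ccontr)
    assume "f \<notin> P"
    then obtain C where C: "C > 0" "\<And>g. g \<in> carrier R \<Longrightarrow> ?q g \<le> C * ?q (f \<otimes> g)"
      using noetherian_multiplication_bounded_below[OF noeth P f] by blast
    have lower: "1 \<le> C ^ n * ?q (f [^] n)" for n :: nat
    proof (induction n)
      case 0
      then show ?case by (simp add: q.nrm_one)
    next
      case (Suc n)
      have "C ^ n * ?q (f [^] n) \<le> C ^ n * (C * ?q (f \<otimes> f [^] n))"
        using C f by (intro mult_left_mono) auto
      also have "\<dots> = C ^ Suc n * ?q (f [^] Suc n)"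
        using f by (simp add: m_comm)
      finally show ?case
        using Suc.IH by linarith
    qed
    \<comment> \<open>any rate strictly between 0 and \<open>1 / C\<close> gives a contradiction\<close>
    have "1 / (2 * C) \<in> growth_rates R ?q f"
      using zero C(1) by (intro q.growth_rate_above[OF f]) auto
    then obtain D where D: "D \<ge> 0" "\<And>n::nat. ?q (f [^] n) \<le> D * (1 / (2 * C)) ^ n" "1 / (2 * C) > 0"
      by (rule q.growth_rateE[OF f]) (rule that)
    have "1 ^ n \<le> D * (1/2) ^ n" for n :: nat
    proof -
      have "1 \<le> C ^ n * (D * (1 / (2 * C)) ^ n)"
        by (rule order_trans[OF lower mult_left_mono[OF D(2)]]) (use C(1) in simp)
      also have "\<dots> = D * (C * (1 / (2 * C))) ^ n"
        by (simp only: power_mult_distrib mult_ac)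
      finally show ?thesis
        using C(1) by simp
    qed
    then have "1 \<le> (1/2 :: real)"
      by (rule le_if_powers_le_const_mult) auto
    then show False by simp
  qed
qed

end

text \<open>For \<open>x\<close> outside a radical ideal, the powers of \<open>x\<close> form a multiplicative set disjoint from it; a
  prime avoiding these powers separates \<open>x\<close> from the ideal.\<close>

lemma (in cring) radical_ideal_eq_Inter_primes:
  assumes J: "radical_ideal R J" "J \<noteq> carrier R"
  shows "{P. primeideal P R \<and> J \<subseteq> P} \<noteq> {}" "J = \<Inter>{P. primeideal P R \<and> J \<subseteq> P}"
proof -
  have ideal: "ideal J R" and rad: "\<And>x n. x \<in> carrier R \<Longrightarrow> n > 0 \<Longrightarrow> x [^] (n::nat) \<in> J \<Longrightarrow> x \<in> J"
    using J(1) by (auto simp: radical_ideal_def radical_def)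
  interpret J: ideal J R by (rule ideal)
  have avoid: "\<exists>P. primeideal P R \<and> J \<subseteq> P \<and> x \<notin> P" if x: "x \<in> carrier R" "x \<notin> J" for x
  proof -
    let ?S = "range (\<lambda>n::nat. x [^] n)"
    have "x [^] n \<notin> J" for n :: nat
      using rad[OF x(1), of n] x(2) J(2) J.one_imp_carrier by (cases "n = 0") auto
    then have disj: "J \<inter> ?S = {}"
      by blast
    have sub: "?S \<subseteq> carrier R"
      using x by auto
    have one: "\<one> \<in> ?S"
      by (rule range_eqI[of _ _ 0]) simp
    have mult: "s \<otimes> t \<in> ?S" if "s \<in> ?S" "t \<in> ?S" for s t
      using that x by (auto simp: nat_pow_mult)
    obtain P where "primeideal P R" "J \<subseteq> P" "P \<inter> ?S = {}"
      by (rule prime_disjoint_from_multiplicative_set[OF ideal disj sub one mult])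
        (assumption, assumption, rule that)
    moreover have "x \<in> ?S"
      by (rule range_eqI[of _ _ 1]) (use x in simp)
    ultimately show ?thesis by blast
  qed
  have "\<one> \<notin> J"
    using J(2) J.one_imp_carrier by blast
  then show "{P. primeideal P R \<and> J \<subseteq> P} \<noteq> {}"
    using avoid[of \<one>] by blast
  then obtain P0 where "primeideal P0 R" "J \<subseteq> P0"
    by blast
  moreover from this have "P0 \<subseteq> carrier R"
    by (simp add: additive_subgroup.a_subset ideal.axioms(1) primeideal.axioms(1))
  ultimately show "J = \<Inter>{P. primeideal P R \<and> J \<subseteq> P}"
    using avoid by blast
qed

lemma (in complete_tate_ring) noetherian_radical_spectrally_reduced:
  assumes noeth: "noetherian_ring R" and J: "radical_ideal R J" "J \<noteq> carrier R"
  shows "spectrally_reduced R nrm J"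
proof -
  have "spectrally_reduced R nrm (\<Inter>{P. primeideal P R \<and> J \<subseteq> P})"
    using noetherian_prime_spectrally_reduced[OF noeth] radical_ideal_eq_Inter_primes(1)[OF J]
    by (intro spectrally_reduced_Inter) auto
  then show ?thesis
    by (simp flip: radical_ideal_eq_Inter_primes(2)[OF J])
qed

text \<open>The image of a scalar \<open>d\<close> with \<open>0 < \<bar>d\<bar> < 1\<close> is the uniformizer; \<open>d\<close> exists because the absolute
  value is nontrivial, after passing to the inverse if necessary.\<close>

lemma (in banach_algebra) exists_complete_tate_ring:
  "\<exists>\<pi>. complete_tate_ring A nrm \<pi>"
proof -
  obtain c where c: "c \<in> carrier K" "c \<noteq> \<zero>\<^bsub>K\<^esub>" "absv c \<noteq> 1"
    using absv_nontrivial by blast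
  have one: "absv \<one>\<^bsub>K\<^esub> = 1"
    using absv_mult[of "\<one>\<^bsub>K\<^esub>" "\<one>\<^bsub>K\<^esub>"] absv_eq_zero[of "\<one>\<^bsub>K\<^esub>"] by simp
  have unit: "inv\<^bsub>K\<^esub> d \<in> carrier K" "d \<otimes>\<^bsub>K\<^esub> inv\<^bsub>K\<^esub> d = \<one>\<^bsub>K\<^esub>" if "d \<in> carrier K" "d \<noteq> \<zero>\<^bsub>K\<^esub>" for d
    using that K.field_Units by auto
  have "\<exists>d\<in>carrier K. d \<noteq> \<zero>\<^bsub>K\<^esub> \<and> absv d < 1"
  proof (cases "absv c < 1")
    case False
    then have "absv c > 1" using c by simp
    moreover have "absv c * absv (inv\<^bsub>K\<^esub> c) = 1"
      using absv_mult[of c "inv\<^bsub>K\<^esub> c"] unit[OF c(1,2)] c one by simp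
    ultimately have "absv (inv\<^bsub>K\<^esub> c) = 1 / absv c" "absv c > 1"
      by (auto simp: field_simps)
    then have "absv (inv\<^bsub>K\<^esub> c) < 1" "absv (inv\<^bsub>K\<^esub> c) \<noteq> 0"
      by auto
    then show ?thesis
      using unit[OF c(1,2)] absv_eq_zero by blast
  qed (use c in blast)
  then obtain d where d: "d \<in> carrier K" "d \<noteq> \<zero>\<^bsub>K\<^esub>" "absv d < 1"
    by blast
  let ?p = "d \<odot>\<^bsub>A\<^esub> \<one>\<^bsub>A\<^esub>"
  have smult: "(a \<odot>\<^bsub>A\<^esub> \<one>\<^bsub>A\<^esub>) \<otimes>\<^bsub>A\<^esub> x = a \<odot>\<^bsub>A\<^esub> x" if "a \<in> carrier K" "x \<in> carrier A" for a x
    using that smult_assoc2[of a "\<one>\<^bsub>A\<^esub>" x] by simp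
  have p: "?p \<in> carrier A" "nrm ?p = absv d"
    using d by (simp_all add: nrm_smult N.nrm_one)
  let ?e = "inv\<^bsub>K\<^esub> d \<odot>\<^bsub>A\<^esub> \<one>\<^bsub>A\<^esub>"
  have e: "?e \<in> carrier A"
    using unit[OF d(1,2)] by simp
  have "cring A"
    by unfold_locales
  then have "?e \<otimes>\<^bsub>A\<^esub> ?p = ?p \<otimes>\<^bsub>A\<^esub> ?e"
    by (rule comm_monoid.m_comm[OF cring.axioms(2) e p(1)])
  moreover have "?p \<otimes>\<^bsub>A\<^esub> ?e = \<one>\<^bsub>A\<^esub>"
    using smult[OF d(1) e] smult_assoc1[of d "inv\<^bsub>K\<^esub> d" "\<one>\<^bsub>A\<^esub>"] unit[OF d(1,2)] d(1)
    by simp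
  ultimately have "?p \<in> Units A"
    using p(1) e unfolding Units_def by auto
  then have "complete_tate_ring A nrm ?p"
    using p d nrm_complete smult nrm_smult by unfold_locales auto
  then show ?thesis by blast
qed

theorem theorem1p2:
  fixes R :: "('a, 'm) ring_scheme" and nrm :: "'a \<Rightarrow> real"
    and K :: "('k, 'l) ring_scheme" and absv :: "'k \<Rightarrow> real"
    and A :: "('k, 'b, 'n) module_scheme" and nrmA :: "'b \<Rightarrow> real"
  shows "(seminormed_ring R nrm \<longrightarrow>
            compact_space (Spec_Top R nrm) \<and> sober_space (Spec_Top R nrm)) \<and>
         (banach_algebra K absv A nrmA \<and> noetherian_ring A \<longrightarrow>
            (\<forall>J. radical_ideal A J \<and> J \<noteq> carrier A \<longrightarrow> spectrally_reduced A nrmA J) \<and>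
            Spec_Top A nrmA = zariski_topology A)"
proof (intro conjI impI)
  assume "seminormed_ring R nrm"
  then interpret ring_seminorm R nrm
    by (rule seminormed_ring.axioms(1))
  show "compact_space (Spec_Top R nrm)" "sober_space (Spec_Top R nrm)"
    by (rule compact_space_Spec_Top sober_space_Spec_Top)+
next
  assume A: "banach_algebra K absv A nrmA \<and> noetherian_ring A"
  then obtain \<pi> where "complete_tate_ring A nrmA \<pi>"
    using banach_algebra.exists_complete_tate_ring by blast
  then interpret complete_tate_ring A nrmA \<pi> .
  show "\<forall>J. radical_ideal A J \<and> J \<noteq> carrier A \<longrightarrow> spectrally_reduced A nrmA J"
    using noetherian_radical_spectrally_reduced A by blast
  have "{p \<in> Spec A. spectrally_reduced A nrmA p} = topspace (zariski_topology A)"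
    using noetherian_prime_spectrally_reduced A by (auto simp: topspace_zariski Spec_def)
  then show "Spec_Top A nrmA = zariski_topology A"
    unfolding Spec_Top_def by (simp add: subtopology_topspace)
qed

end
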